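(* Let $K\subseteq F$ be a field extension with $K$ algebraically closed. Let $A$ and $B$ be $K$-algebras of the same (possibly infinite) dimension $\omega$. Assume that the cardinal of $K$ is strictly greater than $\omega$. Then $A_F$ and $B_F$ are isomorphic as $F$-algebras if and only if $A$ and $B$ are isomorphic as $K$-algebras.
   Context: Algebras are not necessarily associative, commutative or unital. Dimension means the cardinality of a $K$-vector space basis. For a $K$-algebra $A$ and a field extension $K\subseteq F$, $A_F:=A\otimes_K F$, regarded as an $F$-algebra. *)

theory Defs
  imports Complex_Main "HOL-Library.Poly_Mapping" "HOL-Computational_Algebra.Polynomial"
begin

unbundle cardinal_syntax

text \<open>Algebras are neither assumed associative, nor commutative, nor unital: a multiplication is an
  arbitrary bilinear map.\<close>

locale nonassoc_algebra = vector_space scale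
  for scale :: "'k::field \<Rightarrow> 'a::ab_group_add \<Rightarrow> 'a" +
  fixes mul :: "'a \<Rightarrow> 'a \<Rightarrow> 'a"
  assumes mult_add_left: "mul (a + b) c = mul a c + mul b c"
    and mult_add_right: "mul a (b + c) = mul a b + mul a c"
    and mult_scale_left: "mul (scale k a) b = scale k (mul a b)"
    and mult_scale_right: "mul a (scale k b) = scale k (mul a b)"

text \<open>The constant \<open>vector_space.dim\<close> is a natural number, equal to 0 in infinite dimension, so the
  dimension is expressed here as a cardinal. All bases of a vector space are equipotent, hence one
  basis determines the dimension.\<close>

definition (in vector_space) has_dimension :: "'w rel \<Rightarrow> bool" where
  "has_dimension \<omega> \<longleftrightarrow> (\<exists>S. independent S \<and> span S = UNIV \<and> |S| =o \<omega>)"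

text \<open>A field extension is given by its embedding, which is automatically injective.\<close>

locale field_extension =
  fixes emb :: "'k::field \<Rightarrow> 'f::field"
  assumes emb_add: "emb (x + y) = emb x + emb y"
    and emb_mult: "emb (x * y) = emb x * emb y"
    and emb_one: "emb 1 = 1"

text \<open>Since a tensor product depends on the scalar multiplications, which are terms, its carrier
  is a set rather than a type. The following record describes the data of an algebra on a set.\<close>

record ('k, 'a) alg =
  alg_carrier :: "'a set"
  alg_add :: "'a \<Rightarrow> 'a \<Rightarrow> 'a"
  alg_scale :: "'k \<Rightarrow> 'a \<Rightarrow> 'a"
  alg_mult :: "'a \<Rightarrow> 'a \<Rightarrow> 'a"

definition alg_of :: "('k \<Rightarrow> 'a \<Rightarrow> 'a) \<Rightarrow> ('a \<Rightarrow> 'a \<Rightarrow> 'a) \<Rightarrow> ('k, 'a::ab_group_add) alg" where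
  "alg_of scale mul =
     \<lparr>alg_carrier = UNIV, alg_add = (+), alg_scale = scale, alg_mult = mul\<rparr>"

definition alg_isomorphic :: "('k, 'a) alg \<Rightarrow> ('k, 'b) alg \<Rightarrow> bool" (infix \<open>\<cong>\<^sub>a\<close> 50) where
  "A \<cong>\<^sub>a B \<longleftrightarrow> (\<exists>\<phi>. bij_betw \<phi> (alg_carrier A) (alg_carrier B) \<and>
     (\<forall>x\<in>alg_carrier A. \<forall>y\<in>alg_carrier A. \<phi> (alg_add A x y) = alg_add B (\<phi> x) (\<phi> y)) \<and>
     (\<forall>c. \<forall>x\<in>alg_carrier A. \<phi> (alg_scale A c x) = alg_scale B c (\<phi> x)) \<and>
     (\<forall>x\<in>alg_carrier A. \<forall>y\<in>alg_carrier A. \<phi> (alg_mult A x y) = alg_mult B (\<phi> x) (\<phi> y)))"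

text \<open>The tensor product over \<open>'k\<close> of two vector spaces with scalar multiplications \<open>s\<close> and \<open>t\<close> is
  the quotient of the free abelian group on the pairs by the subgroup (that is, the \<open>\<int>\<close>-span)
  generated by the following elements.\<close>

definition tensor_relators ::
  "('k \<Rightarrow> 'a \<Rightarrow> 'a) \<Rightarrow> ('k \<Rightarrow> 'b \<Rightarrow> 'b) \<Rightarrow> ('a::ab_group_add \<times> 'b::ab_group_add \<Rightarrow>\<^sub>0 int) set" where
  "tensor_relators s t =
     {frag_of (a + a', b) - frag_of (a, b) - frag_of (a', b) | a a' b. True} \<union>
     {frag_of (a, b + b') - frag_of (a, b) - frag_of (a, b') | a b b'. True} \<union>
     {frag_of (s k a, b) - frag_of (a, t k b) | k a b. True}"

definition tensor_rel ::
  "('k \<Rightarrow> 'a \<Rightarrow> 'a) \<Rightarrow> ('k \<Rightarrow> 'b \<Rightarrow> 'b) \<Rightarrow> ('a::ab_group_add \<times> 'b::ab_group_add \<Rightarrow>\<^sub>0 int) rel" where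
  "tensor_rel s t = {(x, y). x - y \<in> module.span frag_cmul (tensor_relators s t)}"

text \<open>Representatives: \<open>c \<cdot> (a \<otimes> d) = a \<otimes> (c d)\<close> and \<open>(a \<otimes> c) (b \<otimes> d) = (a b) \<otimes> (c d)\<close>,
  extended additively.\<close>

definition pre_scale :: "'f::field \<Rightarrow> ('a \<times> 'f \<Rightarrow>\<^sub>0 int) \<Rightarrow> ('a \<times> 'f \<Rightarrow>\<^sub>0 int)" where
  "pre_scale c = frag_extend (\<lambda>(a, d). frag_of (a, c * d))"

definition pre_mult ::
  "('a \<Rightarrow> 'a \<Rightarrow> 'a) \<Rightarrow> ('a \<times> 'f::field \<Rightarrow>\<^sub>0 int) \<Rightarrow> ('a \<times> 'f \<Rightarrow>\<^sub>0 int) \<Rightarrow> ('a \<times> 'f \<Rightarrow>\<^sub>0 int)" where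
  "pre_mult mul x y =
     frag_extend (\<lambda>(a, c). frag_extend (\<lambda>(b, d). frag_of (mul a b, c * d)) y) x"

text \<open>The \<open>'f\<close>-algebra \<open>A \<otimes> F\<close>, where \<open>A\<close> has scalar multiplication \<open>s\<close> and multiplication \<open>mul\<close>,
  and \<open>F\<close> is a vector space via \<open>emb\<close>. The lemmas below show that the operations on classes are
  well defined.\<close>

definition base_change ::
  "('k \<Rightarrow> 'f) \<Rightarrow> ('k \<Rightarrow> 'a \<Rightarrow> 'a) \<Rightarrow> ('a \<Rightarrow> 'a \<Rightarrow> 'a) \<Rightarrow>
     ('f::field, ('a::ab_group_add \<times> 'f \<Rightarrow>\<^sub>0 int) set) alg" where
  "base_change emb s mul =
     (let r = tensor_rel s (\<lambda>k c. emb k * c) in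
      \<lparr>alg_carrier = UNIV // r,
       alg_add = (\<lambda>X Y. \<Union>x\<in>X. \<Union>y\<in>Y. r `` {x + y}),
       alg_scale = (\<lambda>c X. \<Union>x\<in>X. r `` {pre_scale c x}),
       alg_mult = (\<lambda>X Y. \<Union>x\<in>X. \<Union>y\<in>Y. r `` {pre_mult mul x y})\<rparr>)"

interpretation frag: module "frag_cmul :: int \<Rightarrow> ('a \<Rightarrow>\<^sub>0 int) \<Rightarrow> ('a \<Rightarrow>\<^sub>0 int)"
  by unfold_locales (simp_all add: frag_cmul_distrib frag_cmul_distrib2)

lemma equiv_tensor_rel: "equiv UNIV (tensor_rel s t)"
proof (rule equivI)
  show "refl (tensor_rel s t)"
    by (simp add: refl_on_def tensor_rel_def frag.span_zero)
  show "sym (tensor_rel s t)"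
  proof (rule symI)
    fix x y assume "(x, y) \<in> tensor_rel s t"
    then have "- (x - y) \<in> frag.span (tensor_relators s t)"
      by (intro frag.span_neg) (simp add: tensor_rel_def)
    then show "(y, x) \<in> tensor_rel s t"
      by (simp add: tensor_rel_def)
  qed
  show "trans (tensor_rel s t)"
  proof (rule transI)
    fix x y z assume "(x, y) \<in> tensor_rel s t" "(y, z) \<in> tensor_rel s t"
    then have "(x - y) + (y - z) \<in> frag.span (tensor_relators s t)"
      by (intro frag.span_add) (simp_all add: tensor_rel_def)
    then show "(x, z) \<in> tensor_rel s t"
      by (simp add: tensor_rel_def)
  qed
qed simp

lemma additive_span:
  assumes "\<And>x y. T (x - y) = T x - T y" "\<And>r. r \<in> R \<Longrightarrow> T r \<in> frag.span N"
    and "x \<in> frag.span R"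
  shows "T x \<in> frag.span N"
proof -
  have T0: "T 0 = 0" using assms(1)[of 0 0] by simp
  have Tm: "T (- x) = - T x" for x using assms(1)[of 0 x] T0 by simp
  have Ta: "T (x + y) = T x + T y" for x y using assms(1)[of x "- y"] Tm by simp
  have Tn: "T (frag_cmul (int n) x) = frag_cmul (int n) (T x)" for n x
    by (induction n) (simp_all add: T0 Ta frag_cmul_distrib)
  have Tc: "T (frag_cmul n x) = frag_cmul n (T x)" for n x
    by (cases n rule: int_cases2) (simp_all add: Tn Tm flip: minus_frag_cmul)
  show ?thesis
    using assms(3)
  proof (induction rule: frag.span_induct_alt)
    case base then show ?case by (simp add: T0 frag.span_zero)
  next
    case (step c x y)
    then show ?case by (simp add: Ta Tc assms(2) frag.span_add frag.span_scale)
  qed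
qed

lemma tensor_relatorsI:
  "frag_of (a + a', b) - frag_of (a, b) - frag_of (a', b) \<in> tensor_relators s t"
  "frag_of (a, b + b') - frag_of (a, b) - frag_of (a, b') \<in> tensor_relators s t"
  "frag_of (s k a, b) - frag_of (a, t k b) \<in> tensor_relators s t"
  unfolding tensor_relators_def by blast+

lemma tensor_relatorsE:
  assumes "r \<in> tensor_relators s t"
  obtains a a' b where "r = frag_of (a + a', b) - frag_of (a, b) - frag_of (a', b)"
  | a b b' where "r = frag_of (a, b + b') - frag_of (a, b) - frag_of (a, b')"
  | k a b where "r = frag_of (s k a, b) - frag_of (a, t k b)"
  using assms unfolding tensor_relators_def by blast

lemma frag_induct:
  assumes "P 0" "\<And>a. P (frag_of a)" "\<And>x y. P x \<Longrightarrow> P y \<Longrightarrow> P (x - y)"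
  shows "P x"
  by (rule frag_induction[where S = UNIV]) (use assms in auto)

lemma pre_mult_zero_left [simp]: "pre_mult m 0 z = 0"
  by (simp add: pre_mult_def)

lemma pre_mult_zero_right [simp]: "pre_mult m z 0 = 0"
  by (auto simp: pre_mult_def intro!: frag_extend_eq_0)

lemma pre_mult_diff_left: "pre_mult m (x - y) z = pre_mult m x z - pre_mult m y z"
  by (simp add: pre_mult_def frag_extend_diff)

lemma pre_mult_diff_right: "pre_mult m z (x - y) = pre_mult m z x - pre_mult m z y"
proof (induction z rule: frag_induct)
  case 2
  then show ?case by (simp add: pre_mult_def frag_extend_diff split: prod.split)
qed (simp_all add: pre_mult_diff_left)

lemma pre_scale_cong:
  assumes "(x, y) \<in> tensor_rel s (\<lambda>k d. emb k * d)"
  shows "(pre_scale c x, pre_scale c y) \<in> tensor_rel s (\<lambda>k d. emb k * d)"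
proof -
  have "pre_scale c (x - y) \<in> frag.span (tensor_relators s (\<lambda>k d. emb k * d))"
  proof (rule additive_span[of "pre_scale c"])
    fix r assume "r \<in> tensor_relators s (\<lambda>k d. emb k * d)"
    then have "pre_scale c r \<in> tensor_relators s (\<lambda>k d. emb k * d)"
      by (cases rule: tensor_relatorsE)
        (simp_all add: pre_scale_def frag_extend_diff distrib_left mult.left_commute[of c]
          tensor_relatorsI[where t = "\<lambda>k d. emb k * d"])
    then show "pre_scale c r \<in> frag.span (tensor_relators s (\<lambda>k d. emb k * d))"
      by (rule frag.span_base)
  qed (use assms in \<open>simp_all add: tensor_rel_def pre_scale_def frag_extend_diff\<close>)
  then show ?thesis
    by (simp add: tensor_rel_def pre_scale_def frag_extend_diff)
qed

lemma (in nonassoc_algebra) pre_mult_cong: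
  assumes "(x, x') \<in> tensor_rel scale (\<lambda>k d. emb k * d)"
    and "(y, y') \<in> tensor_rel scale (\<lambda>k d. emb k * d)"
  shows "(pre_mult mul x y, pre_mult mul x' y') \<in> tensor_rel scale (\<lambda>k d. emb k * d)"
proof -
  let ?R = "tensor_relators scale (\<lambda>k d. emb k * d)"
  note I = tensor_relatorsI[where s = scale and t = "\<lambda>k d. emb k * d"]
  have left: "pre_mult mul r z \<in> frag.span ?R" if "r \<in> ?R" for r z
  proof (induction z rule: frag_induct)
    case (2 p)
    have "pre_mult mul r (frag_of p) \<in> ?R"
      using that
      by (cases p, cases rule: tensor_relatorsE)
        (simp_all add: pre_mult_def frag_extend_diff distrib_right mult.assoc
          mult_add_left mult_scale_left I)
    then show ?case by (rule frag.span_base)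
  qed (simp_all add: pre_mult_diff_right frag.span_diff frag.span_zero)
  have right: "pre_mult mul z r \<in> frag.span ?R" if "r \<in> ?R" for r z
  proof (induction z rule: frag_induct)
    case (2 p)
    have "pre_mult mul (frag_of p) r \<in> ?R"
    proof (cases p)
      case (Pair a c)
      show ?thesis
        using that unfolding Pair
        by (cases rule: tensor_relatorsE)
          (simp_all add: pre_mult_def frag_extend_diff distrib_left mult.left_commute[of c]
            mult_add_right mult_scale_right I)
    qed
    then show ?case by (rule frag.span_base)
  qed (simp_all add: pre_mult_diff_left frag.span_diff frag.span_zero)
  have "pre_mult mul (x - x') y \<in> frag.span ?R"
    using assms(1)
    by (intro additive_span[of "\<lambda>x. pre_mult mul x y", OF pre_mult_diff_left left])
      (simp_all add: tensor_rel_def)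
  moreover have "pre_mult mul x' (y - y') \<in> frag.span ?R"
    using assms(2)
    by (intro additive_span[of "pre_mult mul x'", OF pre_mult_diff_right right])
      (simp_all add: tensor_rel_def)
  ultimately have "pre_mult mul (x - x') y + pre_mult mul x' (y - y') \<in> frag.span ?R"
    by (rule frag.span_add)
  then show ?thesis
    by (simp add: tensor_rel_def pre_mult_diff_left pre_mult_diff_right)
qed

lemma tensor_rel_add:
  assumes "(x, x') \<in> tensor_rel s t" "(y, y') \<in> tensor_rel s t"
  shows "(x + y, x' + y') \<in> tensor_rel s t"
proof -
  have "x - x' \<in> frag.span (tensor_relators s t)" "y - y' \<in> frag.span (tensor_relators s t)"
    using assms by (simp_all add: tensor_rel_def)
  then have "(x - x') + (y - y') \<in> frag.span (tensor_relators s t)"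
    by (rule frag.span_add)
  then show ?thesis
    by (simp only: tensor_rel_def add_diff_add mem_Collect_eq case_prod_conv)
qed

lemma base_change_add:
  "alg_add (base_change emb s m)
     (tensor_rel s (\<lambda>k c. emb k * c) `` {x}) (tensor_rel s (\<lambda>k c. emb k * c) `` {y}) =
   tensor_rel s (\<lambda>k c. emb k * c) `` {x + y}"
  unfolding base_change_def Let_def alg.simps
  by (rule UN_equiv_class2[OF equiv_tensor_rel equiv_tensor_rel _ UNIV_I UNIV_I],
      rule congruent2I', rule equiv_class_eq[OF equiv_tensor_rel], rule tensor_rel_add)

lemma base_change_scale:
  "alg_scale (base_change emb s m) c (tensor_rel s (\<lambda>k c. emb k * c) `` {x}) =
   tensor_rel s (\<lambda>k c. emb k * c) `` {pre_scale c x}"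
  unfolding base_change_def Let_def alg.simps
  by (rule UN_equiv_class[OF equiv_tensor_rel _ UNIV_I],
      rule congruentI, rule equiv_class_eq[OF equiv_tensor_rel], rule pre_scale_cong)

lemma (in nonassoc_algebra) base_change_mult:
  "alg_mult (base_change emb scale mul)
     (tensor_rel scale (\<lambda>k c. emb k * c) `` {x}) (tensor_rel scale (\<lambda>k c. emb k * c) `` {y}) =
   tensor_rel scale (\<lambda>k c. emb k * c) `` {pre_mult mul x y}"
  unfolding base_change_def Let_def alg.simps
  by (rule UN_equiv_class2[OF equiv_tensor_rel equiv_tensor_rel _ UNIV_I UNIV_I],
      rule congruent2I', rule equiv_class_eq[OF equiv_tensor_rel], rule pre_mult_cong)

end

theory Submission
  imports Defs
begin

text \<open>An isomorphism of \<open>K\<close>-algebras extends to the base changes by functoriality. For the converse, let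
  \<open>\<Phi>\<close> be an isomorphism from \<open>A\<^sub>F\<close> to \<open>B\<^sub>F\<close> with inverse \<open>\<Psi>\<close>. With respect to bases of \<open>A\<close> and \<open>B\<close>, these
  maps are matrices over \<open>F\<close> with finitely many nonzero entries in each row, so the set \<open>G\<close> of all entries
  has fewer than \<open>|K|\<close> elements: it is finite if \<open>\<omega>\<close> is finite, and has at most \<open>\<omega>\<close> elements otherwise.
  That \<open>\<Phi>\<close> and \<open>\<Psi>\<close> are multiplicative and inverse to each other amounts to polynomial equations over \<open>K\<close>
  between the entries. A homomorphism of \<open>K\<close>-algebras to \<open>K\<close> from a subalgebra of \<open>F\<close> that contains \<open>G\<close>
  preserves these equations, so the images of the two matrices define inverse isomorphisms between
  \<open>A\<close> and \<open>B\<close>. Instead of matrices, the proof uses the specialization map \<open>a \<otimes> d \<mapsto> h(d) a\<close> that belongs to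
  such a homomorphism \<open>h\<close> (relation \<open>specializes\<close>, locale \<open>specialized_hom\<close>).

  The homomorphism exists by a Nullstellensatz for fewer than \<open>|K|\<close> generators (lemma
  \<open>partial_hom_on_small_set\<close>), which has the same proof for finite and infinite \<open>G\<close>. Let \<open>T\<close> be a maximal
  algebraically independent subset of \<open>G\<close>. Each \<open>g\<close> in \<open>G - T\<close> is a root of a polynomial over \<open>K[T]\<close> with
  leading coefficient \<open>u\<^sub>g \<noteq> 0\<close>. Fewer than \<open>|K|\<close> nonzero polynomials over an infinite field have a common
  non-zero (lemma \<open>polyfuns_common_nonzero\<close>), so there is a homomorphism from \<open>K[T]\<close> to \<open>K\<close> that vanishes at
  none of the \<open>u\<^sub>g\<close>. Extend it to a homomorphism from a subalgebra \<open>R\<close> of \<open>F\<close> to \<open>K\<close> that cannot be extended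
  further. Since \<open>K\<close> is algebraically closed, \<open>R\<close> is a valuation ring of \<open>F\<close> (Chevalley, lemma
  \<open>maximal_hom_valuation\<close>). In particular, \<open>R\<close> is integrally closed. It contains the inverses of the \<open>u\<^sub>g\<close>
  because their images are nonzero, so it contains \<open>G\<close>.\<close>

section \<open>Unions of few finite sets\<close>

text \<open>If the field were finite, the product of all linear factors \<open>X - a\<close>, increased by 1, would have no root.\<close>

lemma infinite_alg_closed_field: "infinite (UNIV :: 'k::alg_closed_field set)"
proof
  assume fin: "finite (UNIV :: 'k set)"
  define p where "p = (\<Prod>a\<in>(UNIV :: 'k set). [:- a, 1:]) + 1"
  have deg: "degree (\<Prod>a\<in>(UNIV :: 'k set). [:- a, 1:]) = card (UNIV :: 'k set)"
    by (subst degree_prod_eq_sum_degree) auto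
  have "card (UNIV :: 'k set) > 0"
    using fin by (simp add: card_gt_0_iff)
  then have "degree p > 0"
    unfolding p_def by (subst degree_add_eq_left) (simp_all add: deg)
  then obtain x where "poly p x = 0"
    using alg_closed_imp_poly_has_root by blast
  moreover have "poly p x = 1"
    using fin by (auto simp: p_def poly_prod)
  ultimately show False by simp
qed

lemma finite_less_infinite_card: "finite A \<Longrightarrow> infinite B \<Longrightarrow> |A| <o |B|"
  by (rule finite_ordLess_infinite[OF card_of_Well_order card_of_Well_order])
    (simp_all add: Field_card_of)

text \<open>A finite family of finite sets has a finite union, and an infinite family has a union that is no
  larger than its index set. The lemma treats both cases at once, so that neither finite and infinite
  dimension nor countable and uncountable \<open>K\<close> have to be separated later.\<close>

lemma card_UNION_finite_less:
  assumes "infinite X" "|I| <o |X|" "\<And>i. i \<in> I \<Longrightarrow> finite (A i)"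
  shows "|\<Union>i\<in>I. A i| <o |X|"
proof (cases "finite I")
  case True
  then show ?thesis
    using assms(1,3) by (intro finite_less_infinite_card) auto
next
  case False
  have "|\<Union>i\<in>I. A i| \<le>o |I|"
  proof (rule card_of_UNION_ordLeq_infinite[OF False])
    show "|I| \<le>o |I|" by (simp add: card_of_refl ordIso_imp_ordLeq)
    show "\<forall>i\<in>I. |A i| \<le>o |I|"
      using finite_less_infinite_card[OF assms(3) False] ordLess_imp_ordLeq by blast
  qed
  then show ?thesis
    using assms(2) by (rule ordLeq_ordLess_trans)
qed

lemma ex_not_in_of_card_less:
  assumes "|B| <o |UNIV :: 'k set|"
  shows "\<exists>k :: 'k. k \<notin> B"
proof (rule ccontr)
  assume "\<not> ?thesis"
  then have "B = UNIV" by auto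
  then show False using assms by (simp add: ordLess_irreflexive)
qed

section \<open>Partial homomorphisms\<close>

context field_extension
begin

lemma emb_zero [simp]: "emb 0 = 0"
proof -
  have "emb 0 + emb 0 = emb 0 + 0" using emb_add[of 0 0] by simp
  then show ?thesis by (rule add_left_imp_eq)
qed

lemma emb_minus: "emb (- x) = - emb x"
  using emb_add[of x "- x"] by (simp add: add_eq_0_iff)

lemma emb_diff: "emb (x - y) = emb x - emb y"
  using emb_add[of x "- y"] by (simp add: emb_minus)

lemma emb_eq_0_iff [simp]: "emb x = 0 \<longleftrightarrow> x = 0"
proof
  assume "emb x = 0"
  then have "emb (x * inverse x) = 0" by (simp add: emb_mult)
  then show "x = 0" using emb_one by (cases "x = 0") auto
qed simp

lemma emb_eq_iff [simp]: "emb x = emb y \<longleftrightarrow> x = y"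
  using emb_diff[of x y] by auto

text \<open>A homomorphism from a subalgebra of \<open>F\<close> to \<open>K\<close> is represented by its graph, which is a
  \<open>K\<close>-subalgebra of \<open>F \<times> K\<close>. Two values \<open>a \<noteq> b\<close> at the same point would put \<open>(0, a - b)\<close>, and after
  multiplication with a constant \<open>(0, 1)\<close>, into the graph. Excluding this single pair therefore makes
  the graph single-valued (lemma \<open>partial_hom_unique\<close>), and this condition is preserved by unions of
  chains.\<close>

definition subalgebra :: "('f \<times> 'k) set \<Rightarrow> bool" where
  "subalgebra r \<longleftrightarrow> (\<forall>k. (emb k, k) \<in> r) \<and>
     (\<forall>x a y b. (x, a) \<in> r \<longrightarrow> (y, b) \<in> r \<longrightarrow> (x + y, a + b) \<in> r \<and> (x * y, a * b) \<in> r)"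

definition partial_hom :: "('f \<times> 'k) set \<Rightarrow> bool" where
  "partial_hom r \<longleftrightarrow> subalgebra r \<and> (0, 1) \<notin> r"

lemma subalgebra_const: "subalgebra r \<Longrightarrow> (emb k, k) \<in> r"
  and subalgebra_add: "subalgebra r \<Longrightarrow> (x, a) \<in> r \<Longrightarrow> (y, b) \<in> r \<Longrightarrow> (x + y, a + b) \<in> r"
  and subalgebra_mult: "subalgebra r \<Longrightarrow> (x, a) \<in> r \<Longrightarrow> (y, b) \<in> r \<Longrightarrow> (x * y, a * b) \<in> r"
  by (auto simp: subalgebra_def)

lemma subalgebra_zero: "subalgebra r \<Longrightarrow> (0, 0) \<in> r"
  using subalgebra_const[of r 0] by simp

lemma subalgebra_one: "subalgebra r \<Longrightarrow> (1, 1) \<in> r"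
  using subalgebra_const[of r 1] by (simp add: emb_one)

lemma subalgebra_diff:
  assumes "subalgebra r" "(x, a) \<in> r" "(y, b) \<in> r"
  shows "(x - y, a - b) \<in> r"
proof -
  have "(emb (- 1) * y, - 1 * b) \<in> r"
    using assms subalgebra_const subalgebra_mult by blast
  then show ?thesis
    using subalgebra_add[OF assms(1,2)] by (fastforce simp: emb_minus emb_one)
qed

lemma subalgebra_power: "subalgebra r \<Longrightarrow> (x, a) \<in> r \<Longrightarrow> (x ^ n, a ^ n) \<in> r"
  by (induction n) (auto intro: subalgebra_one subalgebra_mult)

lemma subalgebra_sum:
  assumes "subalgebra r" "\<And>i. i \<in> I \<Longrightarrow> (f i, g i) \<in> r"
  shows "(sum f I, sum g I) \<in> r"
  using assms(2)
  by (induction I rule: infinite_finite_induct)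
    (auto intro: subalgebra_zero subalgebra_add assms(1))

lemma partial_hom_zero:
  assumes "partial_hom r" "(0, a) \<in> r"
  shows "a = 0"
proof (rule ccontr)
  assume "a \<noteq> 0"
  have "(0 * emb (inverse a), a * inverse a) \<in> r"
    using assms unfolding partial_hom_def by (blast intro: subalgebra_mult subalgebra_const)
  with \<open>a \<noteq> 0\<close> assms(1) show False by (simp add: partial_hom_def)
qed

lemma partial_hom_unique:
  assumes "partial_hom r" "(x, a) \<in> r" "(x, b) \<in> r"
  shows "a = b"
  using partial_hom_zero[OF assms(1), of "a - b"] subalgebra_diff[OF _ assms(2,3)] assms(1)
  by (simp add: partial_hom_def)

inductive_set generated :: "('f \<times> 'k) set \<Rightarrow> ('f \<times> 'k) set" for G where
  base: "p \<in> G \<Longrightarrow> p \<in> generated G"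
| const: "(emb k, k) \<in> generated G"
| add: "(x, a) \<in> generated G \<Longrightarrow> (y, b) \<in> generated G \<Longrightarrow> (x + y, a + b) \<in> generated G"
| mult: "(x, a) \<in> generated G \<Longrightarrow> (y, b) \<in> generated G \<Longrightarrow> (x * y, a * b) \<in> generated G"

lemma subalgebra_generated: "subalgebra (generated G)"
  by (auto simp: subalgebra_def intro: generated.intros)

lemma generated_subset:
  assumes "subalgebra r" "G \<subseteq> r"
  shows "generated G \<subseteq> r"
proof
  fix p assume "p \<in> generated G"
  then show "p \<in> r"
    by induction (use assms subalgebra_const subalgebra_add subalgebra_mult in blast)+
qed

lemma generated_mono: "G \<subseteq> H \<Longrightarrow> generated G \<subseteq> generated H"
  by (rule generated_subset[OF subalgebra_generated]) (auto intro: generated.base)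

lemma generated_finite:
  assumes "p \<in> generated G"
  shows "\<exists>G0. finite G0 \<and> G0 \<subseteq> G \<and> p \<in> generated G0"
  using assms
proof induction
  case (base p)
  then show ?case by (intro exI[of _ "{p}"]) (auto intro: generated.base)
next
  case (const k)
  then show ?case by (intro exI[of _ "{}"]) (auto intro: generated.const)
next
  case (add x a y b)
  then obtain G0 G1 where "finite G0" "G0 \<subseteq> G" "(x, a) \<in> generated G0"
    "finite G1" "G1 \<subseteq> G" "(y, b) \<in> generated G1" by blast
  then show ?case
    using generated_mono[of G0 "G0 \<union> G1"] generated_mono[of G1 "G0 \<union> G1"]
    by (intro exI[of _ "G0 \<union> G1"]) (auto intro: generated.add)
next
  case (mult x a y b)
  then obtain G0 G1 where "finite G0" "G0 \<subseteq> G" "(x, a) \<in> generated G0"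
    "finite G1" "G1 \<subseteq> G" "(y, b) \<in> generated G1" by blast
  then show ?case
    using generated_mono[of G0 "G0 \<union> G1"] generated_mono[of G1 "G0 \<union> G1"]
    by (intro exI[of _ "G0 \<union> G1"]) (auto intro: generated.mult)
qed

text \<open>If \<open>r\<close> is the graph of \<open>h\<close>, these are the pairs \<open>(P, h(P))\<close>, where \<open>P\<close> is a polynomial over the domain
  of \<open>h\<close> and \<open>h\<close> acts on its coefficients.\<close>

definition coeff_pairs :: "('f \<times> 'k) set \<Rightarrow> ('f poly \<times> 'k poly) set" where
  "coeff_pairs r = {(P, Q). \<forall>i. (coeff P i, coeff Q i) \<in> r}"

lemma coeff_pairs_add:
  "subalgebra r \<Longrightarrow> (P, Q) \<in> coeff_pairs r \<Longrightarrow> (P', Q') \<in> coeff_pairs r \<Longrightarrow>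
    (P + P', Q + Q') \<in> coeff_pairs r"
  by (auto simp: coeff_pairs_def intro: subalgebra_add)

lemma coeff_pairs_diff:
  "subalgebra r \<Longrightarrow> (P, Q) \<in> coeff_pairs r \<Longrightarrow> (P', Q') \<in> coeff_pairs r \<Longrightarrow>
    (P - P', Q - Q') \<in> coeff_pairs r"
  by (auto simp: coeff_pairs_def intro: subalgebra_diff)

lemma coeff_pairs_mult:
  "subalgebra r \<Longrightarrow> (P, Q) \<in> coeff_pairs r \<Longrightarrow> (P', Q') \<in> coeff_pairs r \<Longrightarrow>
    (P * P', Q * Q') \<in> coeff_pairs r"
  by (auto simp: coeff_pairs_def coeff_mult intro!: subalgebra_sum subalgebra_mult)

lemma coeff_pairs_C: "subalgebra r \<Longrightarrow> (s, a) \<in> r \<Longrightarrow> ([:s:], [:a:]) \<in> coeff_pairs r"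
  by (auto simp: coeff_pairs_def coeff_pCons subalgebra_zero split: nat.splits)

lemma coeff_pairs_X: "subalgebra r \<Longrightarrow> ([:0, 1:], [:0, 1:]) \<in> coeff_pairs r"
  by (auto simp: coeff_pairs_def coeff_pCons subalgebra_zero subalgebra_one split: nat.splits)

lemma coeff_pairs_lift: "subalgebra r \<Longrightarrow> \<exists>P. (P, Q) \<in> coeff_pairs r"
  by (intro exI[of _ "map_poly emb Q"]) (auto simp: coeff_pairs_def coeff_map_poly subalgebra_const)

text \<open>The graph of the would-be extension of a homomorphism that sends \<open>x\<close> to \<open>c\<close>. It is always a
  subalgebra; the question is whether it contains \<open>(0, 1)\<close>.\<close>

definition adjoin :: "('f \<times> 'k) set \<Rightarrow> 'f \<Rightarrow> 'k \<Rightarrow> ('f \<times> 'k) set" where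
  "adjoin r x c = {(poly P x, poly Q c) | P Q. (P, Q) \<in> coeff_pairs r}"

lemma subalgebra_adjoin:
  assumes "subalgebra r"
  shows "subalgebra (adjoin r x c)" "r \<subseteq> adjoin r x c" "(x, c) \<in> adjoin r x c"
proof -
  show sub: "r \<subseteq> adjoin r x c"
  proof clarify
    fix s a assume "(s, a) \<in> r"
    then show "(s, a) \<in> adjoin r x c"
      unfolding adjoin_def using coeff_pairs_C[OF assms]
      by (intro CollectI exI[of _ "[:s:]"] exI[of _ "[:a:]"]) auto
  qed
  show "(x, c) \<in> adjoin r x c"
    unfolding adjoin_def using coeff_pairs_X[OF assms]
    by (intro CollectI exI[of _ "[:0, 1:]"]) auto
  have "(y + z, a + b) \<in> adjoin r x c \<and> (y * z, a * b) \<in> adjoin r x c"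
    if "(y, a) \<in> adjoin r x c" "(z, b) \<in> adjoin r x c" for y a z b
  proof -
    obtain P Q P' Q' where *: "(P, Q) \<in> coeff_pairs r" "(P', Q') \<in> coeff_pairs r"
      "y = poly P x" "a = poly Q c" "z = poly P' x" "b = poly Q' c"
      using \<open>(y, a) \<in> _\<close> \<open>(z, b) \<in> _\<close> unfolding adjoin_def by blast
    have "y + z = poly (P + P') x" "a + b = poly (Q + Q') c"
      "y * z = poly (P * P') x" "a * b = poly (Q * Q') c"
      by (simp_all add: *)
    then show ?thesis
      unfolding adjoin_def
      using coeff_pairs_add[OF assms *(1,2)] coeff_pairs_mult[OF assms *(1,2)] by blast
  qed
  with sub show "subalgebra (adjoin r x c)"
    unfolding subalgebra_def using subalgebra_const[OF assms] by blast
qed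

section \<open>Maximal homomorphisms and valuation rings\<close>

definition maximal_hom :: "('f \<times> 'k) set \<Rightarrow> bool" where
  "maximal_hom r \<longleftrightarrow> partial_hom r \<and> (\<forall>r'. partial_hom r' \<longrightarrow> r \<subseteq> r' \<longrightarrow> r' = r)"

lemma maximal_hom_exists:
  assumes "partial_hom r"
  shows "\<exists>m. r \<subseteq> m \<and> maximal_hom m"
proof -
  define A where "A = {s. partial_hom s \<and> r \<subseteq> s}"
  have "\<exists>M\<in>A. \<forall>X\<in>A. M \<subseteq> X \<longrightarrow> X = M"
  proof (rule subset_Zorn_nonempty)
    show "A \<noteq> {}" using assms by (auto simp: A_def)
    fix C assume C: "C \<noteq> {}" "subset.chain A C"
    have sub: "subalgebra s" and le: "r \<subseteq> s" and no: "(0, 1) \<notin> s"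
      if "s \<in> C" for s
      using C(2) that by (auto simp: subset.chain_def A_def partial_hom_def)
    have "(x + y, a + b) \<in> \<Union>C \<and> (x * y, a * b) \<in> \<Union>C"
      if xy: "(x, a) \<in> \<Union>C" "(y, b) \<in> \<Union>C" for x a y b
    proof -
      have "finite {(x, a), (y, b)}" "{(x, a), (y, b)} \<subseteq> \<Union>C" using xy by auto
      then obtain s where s: "s \<in> C" "{(x, a), (y, b)} \<subseteq> s"
        using C by (rule finite_subset_Union_chain)
      then have "(x + y, a + b) \<in> s" "(x * y, a * b) \<in> s"
        using sub[OF s(1)] by (simp_all add: subalgebra_add subalgebra_mult)
      then show ?thesis using s(1) by (intro conjI UnionI)
    qed
    moreover obtain s where s: "s \<in> C" using C(1) by blast
    moreover have "(emb k, k) \<in> \<Union>C" for k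
      using s subalgebra_const[OF sub[OF s]] by (rule UnionI)
    moreover have "r \<subseteq> \<Union>C" using le[OF s] s by (meson Union_upper order.trans)
    moreover have "(0, 1) \<notin> \<Union>C" using no by (meson UnionE)
    ultimately show "\<Union>C \<in> A"
      by (simp add: A_def partial_hom_def subalgebra_def)
  qed
  then obtain M where "M \<in> A" "\<And>X. X \<in> A \<Longrightarrow> M \<subseteq> X \<Longrightarrow> X = M" by blast
  then show ?thesis
    by (intro exI[of _ M]) (auto simp: A_def maximal_hom_def)
qed

text \<open>A homomorphism that does not vanish at \<open>y\<close> extends to the fractions with denominator a power of \<open>y\<close>.
  Hence the domain of a maximal homomorphism contains them already.\<close>

lemma maximal_hom_inverse:
  assumes "maximal_hom r" "(y, b) \<in> r" "b \<noteq> 0"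
  shows "(inverse y, inverse b) \<in> r"
proof -
  have ph: "partial_hom r" and sub: "subalgebra r"
    using assms(1) by (auto simp: maximal_hom_def partial_hom_def)
  have "y \<noteq> 0" using partial_hom_zero[OF ph] assms(2,3) by auto
  define r' where "r' = {(s / y ^ n, a / b ^ n) | s a n. (s, a) \<in> r}"
  have in_r': "(s / y ^ n, a / b ^ n) \<in> r'" if "(s, a) \<in> r" for s a n
    using that unfolding r'_def by blast
  have le: "r \<subseteq> r'" using in_r'[of _ _ 0] by auto
  have "(u + v, c + d) \<in> r' \<and> (u * v, c * d) \<in> r'" if uv: "(u, c) \<in> r'" "(v, d) \<in> r'" for u c v d
  proof -
    obtain s a n t e m where *: "(s, a) \<in> r" "(t, e) \<in> r"
      "u = s / y ^ n" "c = a / b ^ n" "v = t / y ^ m" "d = e / b ^ m"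
      using uv unfolding r'_def by blast
    have "u + v = (s * y ^ m + t * y ^ n) / y ^ (n + m)"
      "c + d = (a * b ^ m + e * b ^ n) / b ^ (n + m)"
      "u * v = (s * t) / y ^ (n + m)" "c * d = (a * e) / b ^ (n + m)"
      using \<open>y \<noteq> 0\<close> \<open>b \<noteq> 0\<close> by (simp_all add: * field_simps power_add)
    moreover have "(s * y ^ m + t * y ^ n, a * b ^ m + e * b ^ n) \<in> r" "(s * t, a * e) \<in> r"
      using * assms(2) sub by (auto intro!: subalgebra_add subalgebra_mult subalgebra_power)
    ultimately show ?thesis using in_r' by metis
  qed
  with le have "subalgebra r'" using sub unfolding subalgebra_def by blast
  moreover have "(0, 1) \<notin> r'"
  proof
    assume "(0, 1) \<in> r'"
    then obtain s a n where "(s, a) \<in> r" "s / y ^ n = 0" "a / b ^ n = 1"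
      unfolding r'_def by force
    then show False
      using \<open>y \<noteq> 0\<close> \<open>b \<noteq> 0\<close> partial_hom_zero[OF ph, of a] by auto
  qed
  ultimately have "r' = r"
    using le assms(1) by (auto simp: maximal_hom_def partial_hom_def)
  then show ?thesis
    using in_r'[OF subalgebra_one[OF sub], of 1] by (simp add: inverse_eq_divide)
qed

end

locale alg_closed_extension = field_extension emb
  for emb :: "'k::alg_closed_field \<Rightarrow> 'f::field"
begin

text \<open>The polynomials \<open>h(P)\<close>, where \<open>P\<close> has the root \<open>x\<close>, form an ideal of \<open>K[X]\<close>, and \<open>h\<close> extends by
  \<open>x \<mapsto> c\<close> exactly if \<open>c\<close> is a common root of this ideal. Its generator has a root in \<open>K\<close> unless it is
  a nonzero constant, so \<open>x\<close> cannot be adjoined only if \<open>1\<close> is in the ideal. The pair \<open>(P, 1)\<close> then says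
  that the constant coefficient of \<open>P\<close> goes to 1 and that the others go to 0.\<close>

lemma no_extension_relation:
  assumes "partial_hom r" and no: "\<And>c. \<not> partial_hom (adjoin r x c)"
  shows "\<exists>P. (P, 1) \<in> coeff_pairs r \<and> poly P x = 0"
proof -
  have sub: "subalgebra r" using assms(1) by (simp add: partial_hom_def)
  define J where "J = {Q. \<exists>P. (P, Q) \<in> coeff_pairs r \<and> poly P x = 0}"
  have J_diff: "Q - Q' \<in> J" if Q: "Q \<in> J" "Q' \<in> J" for Q Q'
  proof -
    obtain P P' where *: "(P, Q) \<in> coeff_pairs r" "(P', Q') \<in> coeff_pairs r"
      "poly P x = 0" "poly P' x = 0"
      using Q unfolding J_def by blast
    then show ?thesis
      using coeff_pairs_diff[OF sub *(1,2)] by (auto simp: J_def intro!: exI[of _ "P - P'"])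
  qed
  have J_mult: "Q' * Q \<in> J" if Q: "Q \<in> J" for Q Q'
  proof -
    obtain P where P: "(P, Q) \<in> coeff_pairs r" "poly P x = 0"
      using Q unfolding J_def by blast
    moreover obtain P' where P': "(P', Q') \<in> coeff_pairs r"
      using coeff_pairs_lift[OF sub] by blast
    ultimately have *: "(P, Q) \<in> coeff_pairs r" "(P', Q') \<in> coeff_pairs r" "poly P x = 0"
      by simp_all
    then show ?thesis
      using coeff_pairs_mult[OF sub *(2,1)] by (auto simp: J_def intro!: exI[of _ "P' * P"])
  qed
  have no_root: "\<exists>Q\<in>J. poly Q c \<noteq> 0" for c
  proof -
    have "(0, 1) \<in> adjoin r x c"
      using no[of c] subalgebra_adjoin[OF sub] by (auto simp: partial_hom_def)
    then obtain P Q where *: "(P, Q) \<in> coeff_pairs r" "0 = poly P x" "1 = poly Q c"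
      unfolding adjoin_def by blast
    then have "Q \<in> J" unfolding J_def by (auto intro!: exI[of _ P])
    with *(3) show ?thesis by (auto intro!: bexI[of _ Q])
  qed
  then obtain Q0 where "Q0 \<in> J" "Q0 \<noteq> 0" by (metis poly_0)
  then obtain D where D: "D \<in> J" "D \<noteq> 0"
    and min: "\<And>Q. Q \<in> J \<Longrightarrow> Q \<noteq> 0 \<Longrightarrow> degree D \<le> degree Q"
    using ex_has_least_nat[of "\<lambda>Q. Q \<in> J \<and> Q \<noteq> 0" Q0 degree] by blast
  have dvd: "D dvd Q" if "Q \<in> J" for Q
  proof -
    have "Q mod D \<in> J"
      using J_diff[OF that J_mult[OF D(1), of "Q div D"]] by (simp add: minus_div_mult_eq_mod)
    then have "Q mod D = 0"
      using min[of "Q mod D"] degree_mod_less'[OF D(2), of Q] by fastforce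
    then show ?thesis by auto
  qed
  have "degree D = 0"
  proof (rule ccontr)
    assume "degree D \<noteq> 0"
    then obtain c where "poly D c = 0" using alg_closed_imp_poly_has_root by blast
    then have "poly Q c = 0" if "Q \<in> J" for Q using dvd[OF that] by auto
    with no_root[of c] show False by blast
  qed
  then obtain a where "D = [:a:]" by (metis degree_eq_zeroE)
  with D(2) have "[:inverse a:] * D = 1" by (simp add: one_pCons)
  with J_mult[OF D(1), of "[:inverse a:]"] show ?thesis by (auto simp: J_def)
qed

text \<open>The relation \<open>P'\<close> for \<open>1 / x\<close>, multiplied with \<open>x ^ degree P'\<close>, expresses a multiple of the highest
  power of \<open>x\<close> by lower ones, so it can be used to lower the degree of the relation \<open>P\<close> for \<open>x\<close>.\<close>

lemma relation_reduce:
  assumes "partial_hom r" "x \<noteq> 0"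
    and P: "(P, 1) \<in> coeff_pairs r" "poly P x = 0"
    and P': "(P', 1) \<in> coeff_pairs r" "poly P' (inverse x) = 0"
    and le: "degree P' \<le> degree P"
  shows "\<exists>R. (R, 1) \<in> coeff_pairs r \<and> poly R x = 0 \<and> degree R < degree P"
proof -
  have sub: "subalgebra r" and no: "(0, 1) \<notin> r" using assms(1) by (simp_all add: partial_hom_def)
  define n where "n = degree P"
  define m where "m = degree P'"
  have c0: "(coeff P 0, 1) \<in> r" "(coeff P' 0, 1) \<in> r"
    using P(1) P'(1) by (auto simp: coeff_pairs_def dest: spec[of _ 0])
  then have nz: "coeff P 0 \<noteq> 0" "coeff P' 0 \<noteq> 0" using no by metis+
  have "n > 0"
  proof (rule ccontr)
    assume "\<not> n > 0"
    then obtain a where "P = [:a:]" by (metis degree_eq_zeroE n_def gr0I)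
    then show False using P(2) nz by simp
  qed
  have lead: "(lead_coeff P, 0) \<in> r"
    using P(1) \<open>n > 0\<close> by (auto simp: coeff_pairs_def n_def dest: spec[of _ "degree P"])
  have refl: "(reflect_poly P', monom 1 m) \<in> coeff_pairs r"
    unfolding coeff_pairs_def
  proof clarify
    fix i
    have "(coeff P' (m - i), coeff 1 (m - i)) \<in> r"
      using P'(1) unfolding coeff_pairs_def by blast
    moreover have "coeff 1 (m - i) = coeff (monom 1 m) i" if "i \<le> m"
      using that by (cases "i = m") (simp_all add: coeff_1)
    ultimately show "(coeff (reflect_poly P') i, coeff (monom 1 m) i) \<in> r"
      using subalgebra_zero[OF sub]
      by (cases "i \<le> m"; cases "i = m") (simp_all add: coeff_reflect_poly m_def)
  qed
  have mon: "(monom 1 (n - m), monom 1 (n - m)) \<in> coeff_pairs r"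
    by (auto simp: coeff_pairs_def subalgebra_zero[OF sub] subalgebra_one[OF sub])
  define S where "S = monom 1 (n - m) * reflect_poly P'"
  have "(S, monom 1 (n - m) * monom 1 m) \<in> coeff_pairs r"
    unfolding S_def by (rule coeff_pairs_mult[OF sub mon refl])
  \<comment> \<open>The reversed \<open>P'\<close> has the leading coefficient \<open>coeff P' 0\<close>, so the terms of degree \<open>n\<close> cancel.
    The factor \<open>lead_coeff P\<close> goes to 0, hence the subtraction does not affect the image 1.\<close>
  define R where "R = [:coeff P' 0:] * P - [:lead_coeff P:] * S"
  have "(R, [:1:] * 1 - [:0:] * (monom 1 (n - m) * monom 1 m)) \<in> coeff_pairs r"
    unfolding R_def
    by (intro coeff_pairs_diff coeff_pairs_mult coeff_pairs_C sub c0 P lead) fact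
  then have "(R, 1) \<in> coeff_pairs r" by (simp add: one_pCons)
  moreover have "poly R x = 0"
    using P(2) P'(2) \<open>x \<noteq> 0\<close> by (simp add: R_def S_def poly_reflect_poly_nz)
  moreover have "degree R < n"
  proof -
    have nm: "n = (n - m) + m" using le by (simp add: n_def m_def)
    have "degree S \<le> (n - m) + m"
      unfolding S_def
      by (rule order.trans[OF degree_mult_le])
        (intro add_mono degree_monom_le, simp add: m_def degree_reflect_poly_le)
    then have "degree S \<le> n" using nm by simp
    then have "degree R \<le> n"
      unfolding R_def by (intro degree_diff_le) 
        (simp_all add: n_def degree_smult_le order.trans[OF degree_smult_le])
    moreover have "coeff S n = coeff P' 0"
      unfolding S_def using nm
      by (simp add: coeff_monom_mult coeff_reflect_poly m_def)
    then have "coeff R n = 0" by (simp add: R_def n_def)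
    ultimately show ?thesis
      using \<open>n > 0\<close> by (metis degree_0 leading_coeff_0_iff order_le_less)
  qed
  ultimately show ?thesis by (auto simp: n_def)
qed

text \<open>Infinite descent: of two relations, for \<open>x\<close> and for \<open>1 / x\<close>, the one of larger degree can always be
  replaced by one of smaller degree.\<close>

lemma no_relation_pair:
  assumes "partial_hom r" "x \<noteq> 0"
    and "(P, 1) \<in> coeff_pairs r" "poly P x = 0"
    and "(P', 1) \<in> coeff_pairs r" "poly P' (inverse x) = 0"
  shows False
  using assms(3-)
proof (induction "degree P + degree P'" arbitrary: P P' rule: less_induct)
  case less
  show False
  proof (cases "degree P' \<le> degree P")
    case True
    obtain R where "(R, 1) \<in> coeff_pairs r" "poly R x = 0" "degree R < degree P"
      using relation_reduce[OF assms(1,2) less.prems True] by blast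
    then show False using less.hyps[of R P'] less.prems by auto
  next
    case False
    obtain R where "(R, 1) \<in> coeff_pairs r" "poly R (inverse x) = 0" "degree R < degree P'"
      using relation_reduce[OF assms(1), of "inverse x" P' P] less.prems assms(2) False by auto
    then show False using less.hyps[of P R] less.prems by auto
  qed
qed

lemma maximal_hom_adjoin:
  assumes "maximal_hom r" "partial_hom (adjoin r x c)"
  shows "x \<in> Domain r"
proof -
  have sub: "subalgebra r" using assms(1) by (simp add: maximal_hom_def partial_hom_def)
  have "adjoin r x c = r"
    using assms subalgebra_adjoin(2)[OF sub] by (auto simp: maximal_hom_def)
  then show ?thesis using subalgebra_adjoin(3)[OF sub, of x c] by auto
qed

text \<open>Chevalley's theorem: the domain of a maximal homomorphism is a valuation ring. By maximality, an
  element outside the domain cannot be adjoined, and \<open>x\<close> and \<open>1 / x\<close> cannot both be of this kind.\<close>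

lemma maximal_hom_valuation:
  assumes "maximal_hom r" "x \<noteq> 0"
  shows "x \<in> Domain r \<or> inverse x \<in> Domain r"
proof (rule ccontr)
  assume *: "\<not> ?thesis"
  have "partial_hom r" using assms(1) by (simp add: maximal_hom_def)
  moreover obtain P where "(P, 1) \<in> coeff_pairs r" "poly P x = 0"
    using no_extension_relation[OF \<open>partial_hom r\<close>, of x] maximal_hom_adjoin[OF assms(1)] *
    by blast
  moreover obtain P' where "(P', 1) \<in> coeff_pairs r" "poly P' (inverse x) = 0"
    using no_extension_relation[OF \<open>partial_hom r\<close>, of "inverse x"]
      maximal_hom_adjoin[OF assms(1)] * by blast
  ultimately show False using no_relation_pair assms(2) by blast
qed

text \<open>The leading coefficient is a unit in the domain of \<open>r\<close>, so \<open>x\<close> is integral over this domain, and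
  valuation rings are integrally closed. Concretely, if \<open>x\<close> were outside the domain, then \<open>1 / x\<close>
  would be inside and go to 0, because its inverse is outside. The equation for \<open>x\<close>, divided by
  \<open>x ^ degree P\<close>, would then give \<open>b = 0\<close>.\<close>

lemma maximal_hom_integral:
  assumes max: "maximal_hom r"
    and P: "\<And>i. coeff P i \<in> Domain r" "poly P x = 0"
    and lead: "(lead_coeff P, b) \<in> r" "b \<noteq> 0"
  shows "x \<in> Domain r"
proof (rule ccontr)
  assume no: "x \<notin> Domain r"
  have ph: "partial_hom r" and sub: "subalgebra r"
    using max by (auto simp: maximal_hom_def partial_hom_def)
  have "x \<noteq> 0" using no subalgebra_zero[OF sub] by auto
  then obtain e where e: "(inverse x, e) \<in> r"
    using maximal_hom_valuation[OF max] no by blast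
  have "e = 0"
  proof (rule ccontr)
    assume "e \<noteq> 0"
    from maximal_hom_inverse[OF max e this] no show False by auto
  qed
  obtain h where h: "\<And>i. (coeff P i, h i) \<in> r" using P(1) by (auto simp: Domain_iff) metis
  have "(poly (reflect_poly P) (inverse x), \<Sum>i\<le>degree (reflect_poly P). h (degree P - i) * e ^ i) \<in> r"
    unfolding poly_altdef
    by (intro subalgebra_sum subalgebra_mult subalgebra_power e sub)
      (use h degree_reflect_poly_le[of P] in \<open>auto simp: coeff_reflect_poly\<close>)
  moreover have "poly (reflect_poly P) (inverse x) = 0"
    using \<open>x \<noteq> 0\<close> P(2) by (simp add: poly_reflect_poly_nz)
  moreover have "(\<Sum>i\<le>degree (reflect_poly P). h (degree P - i) * e ^ i) = h (degree P)"
    using \<open>e = 0\<close> by (subst sum.mono_neutral_right[of _ "{0}"]) auto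
  moreover have "h (degree P) = b"
    using partial_hom_unique[OF ph h lead(1)] .
  ultimately show False using partial_hom_zero[OF ph] lead(2) by auto
qed

end

section \<open>Common non-zeros of few polynomial functions\<close>

context field_extension
begin

text \<open>Polynomials in the variables \<open>V\<close> with coefficients in \<open>K\<close> are represented by the functions that they
  induce on \<open>F\<close>. Since the variables are themselves elements of \<open>F\<close>, the value of \<open>f\<close> at the identity
  assignment is an element of the subalgebra \<open>K[V]\<close> of \<open>F\<close>, and all elements arise in this way.\<close>

inductive polyfun :: "'f set \<Rightarrow> (('f \<Rightarrow> 'f) \<Rightarrow> 'f) \<Rightarrow> bool" for V where
  const: "polyfun V (\<lambda>d. emb k)"
| proj: "x \<in> V \<Longrightarrow> polyfun V (\<lambda>d. d x)"
| add: "polyfun V f \<Longrightarrow> polyfun V g \<Longrightarrow> polyfun V (\<lambda>d. f d + g d)"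
| mult: "polyfun V f \<Longrightarrow> polyfun V g \<Longrightarrow> polyfun V (\<lambda>d. f d * g d)"

lemma polyfun_finite_support:
  assumes "polyfun V f"
  shows "\<exists>W. finite W \<and> (\<forall>d d'. (\<forall>x\<in>W. d x = d' x) \<longrightarrow> f d = f d')"
  using assms
proof induction
  case (proj x)
  then show ?case by (intro exI[of _ "{x}"]) simp
next
  case (add f g)
  then obtain W W' where "finite W" "\<forall>d d'. (\<forall>x\<in>W. d x = d' x) \<longrightarrow> f d = f d'"
    "finite W'" "\<forall>d d'. (\<forall>x\<in>W'. d x = d' x) \<longrightarrow> g d = g d'"
    by blast
  then show ?case
    by (intro exI[of _ "W \<union> W'"]) (metis UnI1 UnI2 finite_Un)
next
  case (mult f g)
  then obtain W W' where "finite W" "\<forall>d d'. (\<forall>x\<in>W. d x = d' x) \<longrightarrow> f d = f d'"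
    "finite W'" "\<forall>d d'. (\<forall>x\<in>W'. d x = d' x) \<longrightarrow> g d = g d'"
    by blast
  then show ?case
    by (intro exI[of _ "W \<union> W'"]) (metis UnI1 UnI2 finite_Un)
qed auto

lemma polyfun_one_variable:
  assumes "polyfun V f"
  shows "\<exists>q. \<forall>v. f (d(x := v)) = poly q v"
  using assms
proof induction
  case (const k)
  show ?case by (intro exI[of _ "[:emb k:]"]) simp
next
  case (proj y)
  show ?case by (intro exI[of _ "if y = x then [:0, 1:] else [:d y:]"]) simp
next
  case (add f g)
  then obtain p q where "\<forall>v. f (d(x := v)) = poly p v" "\<forall>v. g (d(x := v)) = poly q v" by blast
  then show ?case by (intro exI[of _ "p + q"]) (simp del: fun_upd_apply)
next
  case (mult f g)
  then obtain p q where "\<forall>v. f (d(x := v)) = poly p v" "\<forall>v. g (d(x := v)) = poly q v" by blast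
  then show ?case by (intro exI[of _ "p * q"]) (simp del: fun_upd_apply)
qed

lemma polyfun_nonzero_extend:
  assumes f: "polyfun V f" "f d \<noteq> 0"
  shows "finite {k. f (d(x := emb k)) = 0}"
proof -
  obtain q where q: "\<forall>v. f (d(x := v)) = poly q v" using polyfun_one_variable[OF f(1)] by blast
  from q[rule_format, of "d x"] have "q \<noteq> 0" using f(2) by auto
  then have "finite (emb -` {v. poly q v = 0})"
    by (intro finite_vimageI poly_roots_finite) (auto intro: injI)
  then show ?thesis using q by (simp add: vimage_def)
qed

text \<open>Zorn's lemma is applied to the partial assignments of values in \<open>K\<close> that extend, separately for each
  \<open>f\<close> in \<open>U\<close>, to an assignment in \<open>F\<close> where \<open>f\<close> does not vanish. This condition passes to unions of
  chains because \<open>f\<close> depends on finitely many variables. A maximal assignment is total: for one more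
  variable, each \<open>f\<close> excludes the finitely many roots of a nonzero polynomial, and fewer than \<open>|K|\<close> sets
  of this kind do not exhaust \<open>K\<close>.\<close>

lemma polyfuns_common_nonzero:
  assumes U: "\<And>f. f \<in> U \<Longrightarrow> polyfun V f" "\<And>f. f \<in> U \<Longrightarrow> f d0 \<noteq> 0"
    and card: "|U| <o |UNIV :: 'k set|" and inf: "infinite (UNIV :: 'k set)"
  shows "\<exists>c. \<forall>f\<in>U. f (\<lambda>x. emb (c x)) \<noteq> 0"
proof (cases "U = {}")
  case False
  define ext where "ext p d \<longleftrightarrow> (\<forall>(x, k)\<in>p. d x = emb k)" for p and d :: "'f \<Rightarrow> 'f"
  define A where "A = {p. \<forall>f\<in>U. \<exists>d. ext p d \<and> f d \<noteq> 0}"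
  have "\<exists>M\<in>A. \<forall>X\<in>A. M \<subseteq> X \<longrightarrow> X = M"
  proof (rule subset_Zorn_nonempty)
    have "{} \<in> A" using U(2) by (auto simp: A_def ext_def)
    then show "A \<noteq> {}" by auto
    fix C assume C: "C \<noteq> {}" "subset.chain A C"
    have CA: "p \<in> A" if "p \<in> C" for p
      using C(2) that by (auto simp: subset.chain_def)
    have unique: "k = k'" if xk: "(x, k) \<in> \<Union>C" "(x, k') \<in> \<Union>C" for x k k'
    proof -
      have "finite {(x, k), (x, k')}" "{(x, k), (x, k')} \<subseteq> \<Union>C" using xk by auto
      then obtain p where p: "p \<in> C" "{(x, k), (x, k')} \<subseteq> p"
        using C by (rule finite_subset_Union_chain)
      \<comment> \<open>Any \<open>f\<close> in \<open>U\<close> provides an assignment that extends \<open>p\<close>, so \<open>p\<close> is single-valued.\<close>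
      obtain f where "f \<in> U" using False by blast
      then obtain d where "ext p d" using CA[OF p(1)] by (auto simp: A_def)
      then have "d x = emb k" "d x = emb k'" using p(2) by (auto simp: ext_def)
      then have "emb k = emb k'" by simp
      then show ?thesis by simp
    qed
    show "\<Union>C \<in> A"
      unfolding A_def
    proof clarify
      fix f assume f: "f \<in> U"
      obtain W where W: "finite W" "\<And>d d'. (\<forall>x\<in>W. d x = d' x) \<Longrightarrow> f d = f d'"
        using polyfun_finite_support[OF U(1)[OF f]] by blast
      define S where "S = {(x, k) \<in> \<Union>C. x \<in> W}"
      have "inj_on fst S" 
      proof (rule inj_onI)
        fix p q assume "p \<in> S" "q \<in> S" "fst p = fst q"
        then show "p = q"
          using unique[of "fst p" "snd p" "snd q"] by (simp add: S_def case_prod_beta prod_eq_iff)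
      qed
      moreover have "fst ` S \<subseteq> W" by (auto simp: S_def)
      ultimately have "finite S" using W(1) by (rule inj_on_finite)
      moreover have "S \<subseteq> \<Union>C" by (auto simp: S_def)
      ultimately obtain p where p: "p \<in> C" "S \<subseteq> p" using C by (rule finite_subset_Union_chain)
      obtain d where d: "ext p d" "f d \<noteq> 0" using CA[OF p(1)] f by (auto simp: A_def)
      define d' where "d' x = (if \<exists>k. (x, k) \<in> \<Union>C then emb (THE k. (x, k) \<in> \<Union>C) else d x)" for x
      have d'_eq: "d' x = emb k" if "(x, k) \<in> \<Union>C" for x k
      proof -
        have "(THE k. (x, k) \<in> \<Union>C) = k" using that unique by (intro the_equality) blast+
        then show ?thesis using that by (auto simp: d'_def)
      qed
      have "d x = d' x" if "x \<in> W" for x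
      proof (cases "\<exists>k. (x, k) \<in> \<Union>C")
        case True
        then obtain k where k: "(x, k) \<in> \<Union>C" by blast
        then have "(x, k) \<in> p" using p(2) that by (auto simp: S_def)
        then have "d x = emb k" using d(1) by (auto simp: ext_def)
        then show ?thesis using d'_eq[OF k] by simp
      qed (auto simp: d'_def)
      then have "f d' \<noteq> 0" using W(2)[of d d'] d(2) by simp
      moreover have "ext (\<Union>C) d'" unfolding ext_def using d'_eq by blast
      ultimately show "\<exists>d. ext (\<Union>C) d \<and> f d \<noteq> 0" by blast
    qed
  qed
  then obtain M where M: "M \<in> A" and max: "\<And>X. X \<in> A \<Longrightarrow> M \<subseteq> X \<Longrightarrow> X = M" by blast
  have "\<exists>k. (x, k) \<in> M" for x
  proof -
    have "\<forall>f\<in>U. \<exists>d. ext M d \<and> f d \<noteq> 0" using M by (simp add: A_def)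
    then obtain D where D: "\<And>f. f \<in> U \<Longrightarrow> ext M (D f)" "\<And>f. f \<in> U \<Longrightarrow> f (D f) \<noteq> 0" by metis
    have "|\<Union>f\<in>U. {k. f ((D f)(x := emb k)) = 0}| <o |UNIV :: 'k set|"
      by (rule card_UNION_finite_less[OF inf card])
        (rule polyfun_nonzero_extend[OF U(1) D(2)])
    from ex_not_in_of_card_less[OF this] obtain k where
      k: "\<And>f. f \<in> U \<Longrightarrow> f ((D f)(x := emb k)) \<noteq> 0" by auto
    show ?thesis
    proof (rule ccontr)
      assume no: "\<not> ?thesis"
      then have "ext (insert (x, k) M) ((D f)(x := emb k))" if "f \<in> U" for f
        using D(1)[OF that] by (auto simp: ext_def)
      then have "insert (x, k) M \<in> A" unfolding A_def using k by blast
      from max[OF this] no show False by blast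
    qed
  qed
  then obtain c where c: "\<And>x. (x, c x) \<in> M" by metis
  have "f (\<lambda>x. emb (c x)) \<noteq> 0" if f: "f \<in> U" for f
  proof -
    obtain d where d: "ext M d" "f d \<noteq> 0" using M f by (auto simp: A_def)
    have "d = (\<lambda>x. emb (c x))" using d(1) c by (fastforce simp: ext_def)
    with d(2) show ?thesis by simp
  qed
  then show ?thesis by blast
qed simp

abbreviation graph_on :: "'f set \<Rightarrow> ('f \<Rightarrow> 'k) \<Rightarrow> ('f \<times> 'k) set" where
  "graph_on T c \<equiv> (\<lambda>t. (t, c t)) ` T"

lemma generated_graph_polyfun:
  assumes "(u, a) \<in> generated (graph_on T c)"
  shows "\<exists>f. polyfun T f \<and> f (\<lambda>x. x) = u"
  using assms
proof (induction "(u, a)" arbitrary: u a)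
  case (base u a)
  then show ?case by (intro exI[of _ "\<lambda>d. d u"]) (auto intro: polyfun.proj)
next
  case (const k)
  show ?case by (intro exI[of _ "\<lambda>d. emb k"]) (auto intro: polyfun.const)
next
  case (add x a y b)
  then obtain f g where "polyfun T f" "f (\<lambda>x. x) = x" "polyfun T g" "g (\<lambda>x. x) = y" by blast
  then show ?case by (intro exI[of _ "\<lambda>d. f d + g d"]) (auto intro: polyfun.add)
next
  case (mult x a y b)
  then obtain f g where "polyfun T f" "f (\<lambda>x. x) = x" "polyfun T g" "g (\<lambda>x. x) = y" by blast
  then show ?case by (intro exI[of _ "\<lambda>d. f d * g d"]) (auto intro: polyfun.mult)
qed

lemma polyfun_generated_graph:
  assumes "polyfun T f"
  shows "\<exists>a. f (\<lambda>x. emb (c x)) = emb a \<and> (f (\<lambda>x. x), a) \<in> generated (graph_on T c)"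
  using assms
proof induction
  case (const k)
  show ?case by (intro exI[of _ k]) (auto intro: generated.const)
next
  case (proj x)
  then show ?case by (intro exI[of _ "c x"]) (auto intro: generated.base)
next
  case (add f g)
  then obtain a b where "f (\<lambda>x. emb (c x)) = emb a" "(f (\<lambda>x. x), a) \<in> generated (graph_on T c)"
    "g (\<lambda>x. emb (c x)) = emb b" "(g (\<lambda>x. x), b) \<in> generated (graph_on T c)" by blast
  then show ?case by (intro exI[of _ "a + b"]) (auto simp: emb_add intro: generated.add)
next
  case (mult f g)
  then obtain a b where "f (\<lambda>x. emb (c x)) = emb a" "(f (\<lambda>x. x), a) \<in> generated (graph_on T c)"
    "g (\<lambda>x. emb (c x)) = emb b" "(g (\<lambda>x. x), b) \<in> generated (graph_on T c)" by blast
  then show ?case by (intro exI[of _ "a * b"]) (auto simp: emb_mult intro: generated.mult)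
qed

section \<open>Homomorphisms defined on a given small set\<close>

text \<open>Algebraic independence over \<open>K\<close>, in the form in which it is used: all values in \<open>K\<close> may be prescribed
  on \<open>T\<close>. For infinite \<open>K\<close> this is equivalent to the absence of polynomial relations in \<open>T\<close>.\<close>

definition alg_independent :: "'f set \<Rightarrow> bool" where
  "alg_independent T \<longleftrightarrow> (\<forall>c. (0, 1) \<notin> generated (graph_on T c))"

lemma alg_independent_partial_hom: "alg_independent T \<Longrightarrow> partial_hom (generated (graph_on T c))"
  by (simp add: alg_independent_def partial_hom_def subalgebra_generated)

lemma alg_independent_empty: "alg_independent {}"
proof -
  have "x = emb a" if "(x, a) \<in> generated {}" for x a
    using that by (induction "(x, a)" arbitrary: x a) (simp_all add: emb_add emb_mult)
  then show ?thesis by (fastforce simp: alg_independent_def emb_one)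
qed

lemma alg_independent_Union_chain:
  assumes C: "C \<noteq> {}" "subset.chain A C" and indep: "\<And>T. T \<in> C \<Longrightarrow> alg_independent T"
  shows "alg_independent (\<Union>C)"
  unfolding alg_independent_def
proof (intro allI notI)
  fix c assume "(0, 1) \<in> generated (graph_on (\<Union>C) c)"
  then obtain G where G: "finite G" "G \<subseteq> graph_on (\<Union>C) c" "(0, 1) \<in> generated G"
    using generated_finite by blast
  then have "finite (fst ` G)" "fst ` G \<subseteq> \<Union>C" by (simp, force)
  then obtain T where T: "T \<in> C" "fst ` G \<subseteq> T" using C by (rule finite_subset_Union_chain)
  then have "G \<subseteq> graph_on T c" using G(2) by force
  then have "(0, 1) \<in> generated (graph_on T c)" using G(3) generated_mono by blast
  then show False using indep[OF T(1)] by (simp add: alg_independent_def)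
qed

lemma maximal_alg_independent_exists:
  "\<exists>T\<subseteq>G. alg_independent T \<and> (\<forall>g\<in>G - T. \<not> alg_independent (insert g T))"
proof -
  define A where "A = {T. T \<subseteq> G \<and> alg_independent T}"
  have "\<exists>M\<in>A. \<forall>X\<in>A. M \<subseteq> X \<longrightarrow> X = M"
  proof (rule subset_Zorn_nonempty)
    show "A \<noteq> {}" using alg_independent_empty by (auto simp: A_def)
    fix C assume C: "C \<noteq> {}" "subset.chain A C"
    then have "T \<subseteq> G" "alg_independent T" if "T \<in> C" for T
      using that by (auto simp: subset.chain_def A_def)
    then show "\<Union>C \<in> A"
      using alg_independent_Union_chain[OF C] by (simp add: A_def Union_least)
  qed
  then obtain M where M: "M \<in> A" and max: "\<And>X. X \<in> A \<Longrightarrow> M \<subseteq> X \<Longrightarrow> X = M" by blast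
  have "\<not> alg_independent (insert g M)" if "g \<in> G - M" for g
    using max[of "insert g M"] M that by (auto simp: A_def)
  with M show ?thesis by (auto simp: A_def)
qed

text \<open>Some prescription of values on \<open>T\<close> and at \<open>g\<close> is inconsistent, although its restriction to \<open>T\<close> is
  not. The obstruction is a polynomial with root \<open>g\<close> whose image does not vanish at the prescribed
  value; in particular, it is not zero.\<close>

lemma not_alg_independent_algebraic:
  assumes "alg_independent T" "\<not> alg_independent (insert g T)"
  shows "\<exists>P. P \<noteq> 0 \<and> poly P g = 0 \<and> (\<forall>i. \<exists>f. polyfun T f \<and> f (\<lambda>x. x) = coeff P i)"
proof -
  obtain c where c: "(0, 1) \<in> generated (graph_on (insert g T) c)"
    using assms(2) by (auto simp: alg_independent_def)
  define r where "r = generated (graph_on T c)"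
  have sub: "subalgebra r" by (simp add: r_def subalgebra_generated)
  have "graph_on T c \<subseteq> r" by (auto simp: r_def intro: generated.base)
  then have "graph_on (insert g T) c \<subseteq> adjoin r g (c g)"
    using subalgebra_adjoin(2,3)[OF sub, where x = g and c = "c g"] by auto
  then have "(0, 1) \<in> adjoin r g (c g)"
    using c generated_subset[OF subalgebra_adjoin(1)[OF sub]] by blast
  then obtain P Q where PQ: "(P, Q) \<in> coeff_pairs r" "0 = poly P g" "1 = poly Q (c g)"
    unfolding adjoin_def by blast
  have "P \<noteq> 0"
  proof
    assume "P = 0"
    have "Q = 0"
    proof (rule poly_eqI)
      fix i
      have "(0, coeff Q i) \<in> r" using PQ(1) \<open>P = 0\<close> by (auto simp: coeff_pairs_def)
      then show "coeff Q i = coeff 0 i"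
        using partial_hom_zero[OF alg_independent_partial_hom[OF assms(1)]] by (simp add: r_def)
    qed
    with PQ(3) show False by simp
  qed
  moreover have "\<exists>f. polyfun T f \<and> f (\<lambda>x. x) = coeff P i" for i
    using PQ(1) generated_graph_polyfun unfolding coeff_pairs_def r_def by blast
  ultimately show ?thesis using PQ(2) by auto
qed

end

context alg_closed_extension
begin

text \<open>A Nullstellensatz for fewer than \<open>|K|\<close> generators. Let \<open>T\<close> be a maximal algebraically independent
  subset of \<open>G\<close>. Each other element of \<open>G\<close> satisfies a polynomial equation over \<open>K[T]\<close>, and there is a
  homomorphism from \<open>K[T]\<close> to \<open>K\<close> that is nonzero at the leading coefficients of all these equations.
  All its maximal extensions are defined on \<open>G\<close> by lemma \<open>maximal_hom_integral\<close>.\<close>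

lemma partial_hom_on_small_set:
  assumes "|G| <o |UNIV :: 'k set|"
  shows "\<exists>r. partial_hom r \<and> G \<subseteq> Domain r"
proof -
  obtain T where T: "T \<subseteq> G" "alg_independent T" "\<And>g. g \<in> G - T \<Longrightarrow> \<not> alg_independent (insert g T)"
    using maximal_alg_independent_exists[of G] by blast
  have "\<exists>P F. P \<noteq> 0 \<and> poly P g = 0 \<and> (\<forall>i. polyfun T (F i) \<and> F i (\<lambda>x. x) = coeff P i)"
    if "g \<in> G - T" for g
    using not_alg_independent_algebraic[OF T(2) T(3)[OF that]] by metis
  then obtain P F where PF: "\<And>g. g \<in> G - T \<Longrightarrow> P g \<noteq> 0" "\<And>g. g \<in> G - T \<Longrightarrow> poly (P g) g = 0"
    "\<And>g i. g \<in> G - T \<Longrightarrow> polyfun T (F g i)"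
    "\<And>g i. g \<in> G - T \<Longrightarrow> F g i (\<lambda>x. x) = coeff (P g) i"
    by metis
  define U where "U = (\<lambda>g. F g (degree (P g))) ` (G - T)"
  have "|U| \<le>o |G|"
    unfolding U_def by (rule ordLeq_transitive[OF card_of_image card_of_mono1]) auto
  then have card: "|U| <o |UNIV :: 'k set|" using assms by (rule ordLeq_ordLess_trans)
  have "\<exists>c. \<forall>f\<in>U. f (\<lambda>x. emb (c x)) \<noteq> 0"
    by (rule polyfuns_common_nonzero[OF _ _ card infinite_alg_closed_field, of T "\<lambda>x. x"])
      (use PF in \<open>auto simp: U_def\<close>)
  then obtain c where c: "\<And>g. g \<in> G - T \<Longrightarrow> F g (degree (P g)) (\<lambda>x. emb (c x)) \<noteq> 0"
    by (auto simp: U_def)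
  define r0 where "r0 = generated (graph_on T c)"
  obtain r where r: "r0 \<subseteq> r" "maximal_hom r"
    using maximal_hom_exists[OF alg_independent_partial_hom[OF T(2)]] unfolding r0_def by blast
  have "g \<in> Domain r" if g: "g \<in> G - T" for g
  proof -
    have coeff: "\<exists>a. F g i (\<lambda>x. emb (c x)) = emb a \<and> (coeff (P g) i, a) \<in> r" for i
      using polyfun_generated_graph[OF PF(3)[OF g], of i c] PF(4)[OF g] r(1) unfolding r0_def by auto
    then obtain b where b: "F g (degree (P g)) (\<lambda>x. emb (c x)) = emb b" "(lead_coeff (P g), b) \<in> r"
      by blast
    then have "b \<noteq> 0" using c[OF g] by auto
    show ?thesis
      by (rule maximal_hom_integral[OF r(2) _ PF(2)[OF g] b(2) \<open>b \<noteq> 0\<close>]) (use coeff in blast)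
  qed
  moreover have "T \<subseteq> Domain r"
    using r(1) by (force simp: r0_def intro: generated.base)
  ultimately show ?thesis
    using r(2) by (auto simp: maximal_hom_def)
qed

end

section \<open>Coordinates in the tensor product\<close>

text \<open>The additive extension of \<open>f\<close> from the generators to the free abelian group.\<close>

definition frag_sum :: "('p \<Rightarrow> 'f::comm_ring_1) \<Rightarrow> ('p \<Rightarrow>\<^sub>0 int) \<Rightarrow> 'f" where
  "frag_sum f x = (\<Sum>p\<in>Poly_Mapping.keys x. of_int (Poly_Mapping.lookup x p) * f p)"

lemma frag_sum_superset:
  assumes "finite A" "Poly_Mapping.keys x \<subseteq> A"
  shows "frag_sum f x = (\<Sum>p\<in>A. of_int (Poly_Mapping.lookup x p) * f p)"
  unfolding frag_sum_def using assms
  by (intro sum.mono_neutral_left) (auto simp: in_keys_iff)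

lemma frag_sum_of [simp]: "frag_sum f (frag_of p) = f p"
  by (simp add: frag_sum_def)

lemma frag_sum_zero [simp]: "frag_sum f 0 = 0"
  by (simp add: frag_sum_def)

lemma frag_sum_add: "frag_sum f (x + y) = frag_sum f x + frag_sum f y"
proof -
  let ?A = "Poly_Mapping.keys x \<union> Poly_Mapping.keys y"
  have "Poly_Mapping.keys (x + y) \<subseteq> ?A" by (rule keys_add)
  then show ?thesis
    by (simp add: frag_sum_superset[of ?A] lookup_add distrib_right sum.distrib)
qed

lemma frag_sum_cmul: "frag_sum f (frag_cmul c x) = of_int c * frag_sum f x"
  using keys_cmul[of c x]
  by (simp add: frag_sum_superset[of "Poly_Mapping.keys x"] sum_distrib_left mult.assoc)

lemma frag_sum_diff: "frag_sum f (x - y) = frag_sum f x - frag_sum f y"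
  using frag_sum_add[of f "x - y" y] by simp

lemma frag_sum_sum: "frag_sum f (sum g I) = (\<Sum>i\<in>I. frag_sum f (g i))"
  by (induction I rule: infinite_finite_induct) (simp_all add: frag_sum_add)

lemma frag_sum_tensor_rel:
  assumes "\<And>\<rho>. \<rho> \<in> tensor_relators s t \<Longrightarrow> frag_sum f \<rho> = 0" "(x, y) \<in> tensor_rel s t"
  shows "frag_sum f x = frag_sum f y"
proof -
  have "x - y \<in> frag.span (tensor_relators s t)" using assms(2) by (simp add: tensor_rel_def)
  then have "frag_sum f (x - y) = 0"
    by (induction rule: frag.span_induct_alt) (simp_all add: frag_sum_add frag_sum_cmul assms(1))
  then show ?thesis by (simp add: frag_sum_diff)
qed

lemma tensor_rel_refl: "(x, x) \<in> tensor_rel s t"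
  by (simp add: tensor_rel_def frag.span_zero)

lemma tensor_rel_sym: "(x, y) \<in> tensor_rel s t \<Longrightarrow> (y, x) \<in> tensor_rel s t"
  using equiv_tensor_rel[of s t] by (meson equivE symE)

lemma tensor_rel_trans:
  "(x, y) \<in> tensor_rel s t \<Longrightarrow> (y, z) \<in> tensor_rel s t \<Longrightarrow> (x, z) \<in> tensor_rel s t"
  using equiv_tensor_rel[of s t] by (meson equivE transE)

lemma tensor_rel_diff:
  assumes "(x, x') \<in> tensor_rel s t" "(y, y') \<in> tensor_rel s t"
  shows "(x - y, x' - y') \<in> tensor_rel s t"
proof -
  have "(x - x') - (y - y') \<in> frag.span (tensor_relators s t)"
    using assms frag.span_diff unfolding tensor_rel_def by blast
  then show ?thesis by (simp add: tensor_rel_def algebra_simps)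
qed

lemma tensor_rel_sum:
  "(\<And>i. i \<in> I \<Longrightarrow> (f i, g i) \<in> tensor_rel s t) \<Longrightarrow> (sum f I, sum g I) \<in> tensor_rel s t"
  by (induction I rule: infinite_finite_induct) (auto intro: tensor_rel_refl tensor_rel_add)

lemma tensor_rel_of_add_left:
  "(frag_of (a + a', b), frag_of (a, b) + frag_of (a', b)) \<in> tensor_rel s t"
  using frag.span_base[OF tensor_relatorsI(1)] by (simp add: tensor_rel_def diff_diff_eq)

lemma tensor_rel_of_add_right:
  "(frag_of (a, b + b'), frag_of (a, b) + frag_of (a, b')) \<in> tensor_rel s t"
  using frag.span_base[OF tensor_relatorsI(2)] by (simp add: tensor_rel_def diff_diff_eq)

lemma tensor_rel_of_scale: "(frag_of (s k a, b), frag_of (a, t k b)) \<in> tensor_rel s t"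
  using frag.span_base[OF tensor_relatorsI(3)] by (simp add: tensor_rel_def)

lemma tensor_rel_of_zero_left: "(frag_of (0, b), 0) \<in> tensor_rel s t"
  using tensor_rel_diff[OF tensor_rel_of_add_left[of 0 0 b s t] tensor_rel_refl[of "frag_of (0, b)"]]
  by (auto intro: tensor_rel_sym)

lemma tensor_rel_of_zero_right: "(frag_of (a, 0), 0) \<in> tensor_rel s t"
  using tensor_rel_diff[OF tensor_rel_of_add_right[of a 0 0 s t] tensor_rel_refl[of "frag_of (a, 0)"]]
  by (auto intro: tensor_rel_sym)

lemma tensor_rel_of_sum_left:
  "(frag_of (sum f I, b), \<Sum>i\<in>I. frag_of (f i, b)) \<in> tensor_rel s t"
proof (induction I rule: infinite_finite_induct)
  case (insert i I)
  have "(frag_of (f i, b) + frag_of (sum f I, b),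
      frag_of (f i, b) + (\<Sum>i\<in>I. frag_of (f i, b))) \<in> tensor_rel s t"
    by (intro tensor_rel_add tensor_rel_refl insert.IH)
  then show ?case
    using insert.hyps tensor_rel_trans[OF tensor_rel_of_add_left] by simp
qed (simp_all add: tensor_rel_of_zero_left)

lemma tensor_rel_of_diff_right:
  "(frag_of (a, b - b'), frag_of (a, b) - frag_of (a, b')) \<in> tensor_rel s t"
  using tensor_rel_sym[OF tensor_rel_diff[OF tensor_rel_of_add_right[of a "b - b'" b' s t]
    tensor_rel_refl[of "frag_of (a, b')"]]]
  by (auto intro: tensor_rel_sym)

locale tensor_coordinates = field_extension emb + vector_space scale
  for emb :: "'k::field \<Rightarrow> 'f::field" and scale :: "'k \<Rightarrow> 'a::ab_group_add \<Rightarrow> 'a" +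
  fixes S :: "'a set"
  assumes independent: "independent S" and span_eq: "span S = UNIV"
begin

abbreviation tensor_eq :: "('a \<times> 'f \<Rightarrow>\<^sub>0 int) rel" where
  "tensor_eq \<equiv> tensor_rel scale (\<lambda>k c. emb k * c)"

definition coordinate :: "'a \<Rightarrow> ('a \<times> 'f \<Rightarrow>\<^sub>0 int) \<Rightarrow> 'f" where
  "coordinate j = frag_sum (\<lambda>(b, d). emb (representation S b j) * d)"

lemma coordinate_cong:
  assumes "(x, y) \<in> tensor_eq"
  shows "coordinate j x = coordinate j y"
  unfolding coordinate_def
proof (rule frag_sum_tensor_rel[OF _ assms])
  fix \<rho> assume "\<rho> \<in> tensor_relators scale (\<lambda>k c. emb k * c)"
  then show "frag_sum (\<lambda>(b, d). emb (representation S b j) * d) \<rho> = 0"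
    by (cases rule: tensor_relatorsE)
      (simp_all add: frag_sum_diff representation_add representation_scale independent span_eq
        emb_add emb_mult distrib_left distrib_right mult.assoc mult.left_commute)
qed

lemma coordinate_of_basis:
  "i \<in> S \<Longrightarrow> coordinate j (frag_of (i, d)) = (if j = i then d else 0)"
  by (simp add: coordinate_def representation_basis independent emb_one)

text \<open>Existence of an expansion with coefficients in \<open>F\<close> with respect to the basis \<open>S\<close>. The coefficients
  are given by a function that vanishes outside \<open>J\<close>, so that two expansions can be extended to a common
  index set and subtracted.\<close>

lemma tensor_eq_expansion:
  "\<exists>J e. finite J \<and> J \<subseteq> S \<and> (\<forall>j. j \<notin> J \<longrightarrow> e j = 0) \<and> (z, \<Sum>j\<in>J. frag_of (j, e j)) \<in> tensor_eq"
proof (induction z rule: frag_induct)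
  case 1
  show ?case by (intro exI[of _ "{}"] exI[of _ "\<lambda>_. 0"]) (simp add: tensor_rel_refl)
next
  case (2 p)
  obtain b d where p: "p = (b, d)" by (cases p)
  define J where "J = {j. representation S b j \<noteq> 0}"
  have J: "finite J" "J \<subseteq> S" 
    unfolding J_def using finite_representation representation_ne_zero by blast+
  have b: "b = (\<Sum>j\<in>J. scale (representation S b j) j)"
    unfolding J_def using sum_nonzero_representation_eq[OF independent] span_eq by simp
  have "(frag_of (\<Sum>j\<in>J. scale (representation S b j) j, d),
      \<Sum>j\<in>J. frag_of (scale (representation S b j) j, d)) \<in> tensor_eq"
    by (rule tensor_rel_of_sum_left)
  then have "(frag_of (b, d), \<Sum>j\<in>J. frag_of (scale (representation S b j) j, d)) \<in> tensor_eq"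
    by (simp only: b[symmetric])
  moreover have "(\<Sum>j\<in>J. frag_of (scale (representation S b j) j, d),
      \<Sum>j\<in>J. frag_of (j, emb (representation S b j) * d)) \<in> tensor_eq"
    by (intro tensor_rel_sum tensor_rel_of_scale)
  ultimately have "(frag_of (b, d), \<Sum>j\<in>J. frag_of (j, emb (representation S b j) * d)) \<in> tensor_eq"
    by (rule tensor_rel_trans)
  then show ?case
    using J unfolding p
    by (intro exI[of _ J] exI[of _ "\<lambda>j. emb (representation S b j) * d"]) (simp add: J_def)
next
  case (3 x y)
  then obtain J e J' e' where J: "finite J" "J \<subseteq> S" "\<And>j. j \<notin> J \<Longrightarrow> e j = 0"
      "(x, \<Sum>j\<in>J. frag_of (j, e j)) \<in> tensor_eq"
    and J': "finite J'" "J' \<subseteq> S" "\<And>j. j \<notin> J' \<Longrightarrow> e' j = 0"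
      "(y, \<Sum>j\<in>J'. frag_of (j, e' j)) \<in> tensor_eq"
    by blast
  have extend: "(\<Sum>j\<in>I. frag_of (j, f j), \<Sum>j\<in>I \<union> I'. frag_of (j, f j)) \<in> tensor_eq"
    if I: "finite I" "finite I'" "\<And>j. j \<notin> I \<Longrightarrow> f j = 0" for I I' f
  proof -
    have "(\<Sum>j\<in>I' - I. frag_of (j, f j), \<Sum>j\<in>I' - I. 0) \<in> tensor_eq"
      by (rule tensor_rel_sum) (use I(3) in \<open>simp add: tensor_rel_of_zero_right\<close>)
    then have "((\<Sum>j\<in>I. frag_of (j, f j)) + (\<Sum>j\<in>I' - I. frag_of (j, f j)),
        (\<Sum>j\<in>I. frag_of (j, f j)) + 0) \<in> tensor_eq"
      by (intro tensor_rel_add tensor_rel_refl) simp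
    moreover have "(\<Sum>j\<in>I \<union> I'. frag_of (j, f j)) =
        (\<Sum>j\<in>I. frag_of (j, f j)) + (\<Sum>j\<in>I' - I. frag_of (j, f j))"
      using I by (subst sum.union_disjoint[symmetric]) auto
    ultimately show ?thesis by (simp add: tensor_rel_sym)
  qed
  have "(x, \<Sum>j\<in>J \<union> J'. frag_of (j, e j)) \<in> tensor_eq"
    using J(4) extend[OF J(1) J'(1) J(3)] by (rule tensor_rel_trans)
  moreover have "(y, \<Sum>j\<in>J \<union> J'. frag_of (j, e' j)) \<in> tensor_eq"
    using J'(4) extend[OF J'(1) J(1) J'(3)] by (simp add: Un_commute) (rule tensor_rel_trans)
  ultimately have "(x - y, \<Sum>j\<in>J \<union> J'. frag_of (j, e j) - frag_of (j, e' j)) \<in> tensor_eq"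
    unfolding sum_subtractf by (rule tensor_rel_diff)
  moreover have "(\<Sum>j\<in>J \<union> J'. frag_of (j, e j) - frag_of (j, e' j),
      \<Sum>j\<in>J \<union> J'. frag_of (j, e j - e' j)) \<in> tensor_eq"
    by (intro tensor_rel_sum tensor_rel_sym[OF tensor_rel_of_diff_right])
  ultimately have "(x - y, \<Sum>j\<in>J \<union> J'. frag_of (j, e j - e' j)) \<in> tensor_eq"
    by (rule tensor_rel_trans)
  then show ?case
    using J J' by (intro exI[of _ "J \<union> J'"] exI[of _ "\<lambda>j. e j - e' j"]) auto
qed

text \<open>The coordinates respect the tensor relations, so they can be read off from any expansion. In
  particular, tensors with the same coordinates are equal.\<close>

lemma coordinate_expansion:
  obtains J where "finite J" "\<And>j. j \<notin> J \<Longrightarrow> coordinate j z = 0"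
    "(z, \<Sum>j\<in>J. frag_of (j, coordinate j z)) \<in> tensor_eq"
proof -
  obtain J e where J: "finite J" "J \<subseteq> S" "\<And>j. j \<notin> J \<Longrightarrow> e j = 0"
      "(z, \<Sum>j\<in>J. frag_of (j, e j)) \<in> tensor_eq"
    using tensor_eq_expansion[of z] by blast
  have "coordinate i z = e i" for i
  proof -
    have "coordinate i z = (\<Sum>j\<in>J. coordinate i (frag_of (j, e j)))"
      using coordinate_cong[OF J(4)] by (simp add: coordinate_def frag_sum_sum)
    also have "\<dots> = (\<Sum>j\<in>J. if i = j then e j else 0)"
      using J(2) by (intro sum.cong refl) (auto simp: coordinate_of_basis)
    also have "\<dots> = e i" using J(1,3) by simp
    finally show ?thesis .
  qed
  with J show ?thesis by (intro that) auto
qed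

lemma finite_coordinates: "finite (range (\<lambda>j. coordinate j z))"
proof -
  obtain J where "finite J" "\<And>j. j \<notin> J \<Longrightarrow> coordinate j z = 0"
    using coordinate_expansion by blast
  then have "range (\<lambda>j. coordinate j z) \<subseteq> insert 0 ((\<lambda>j. coordinate j z) ` J)" by auto
  then show ?thesis using \<open>finite J\<close> finite_subset by blast
qed

end

section \<open>Specialization of tensors\<close>

text \<open>If \<open>r\<close> is the graph of a homomorphism \<open>h\<close> from \<open>R\<close> to \<open>K\<close>, then this relation is the map
  \<open>a \<otimes> d \<mapsto> h(d) a\<close> from the image of \<open>A \<otimes> R\<close> in \<open>A \<otimes> F\<close> to \<open>A\<close>. As an inductive relation it is compatible
  with the algebra operations and with homomorphisms by plain induction; only uniqueness and
  existence need coordinates.\<close>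

inductive specializes ::
  "('f::field \<times> 'k) set \<Rightarrow> ('k \<Rightarrow> 'f) \<Rightarrow> ('k \<Rightarrow> 'a \<Rightarrow> 'a) \<Rightarrow>
     ('a::ab_group_add \<times> 'f \<Rightarrow>\<^sub>0 int) \<Rightarrow> 'a \<Rightarrow> bool"
  for r emb s where
  zero: "specializes r emb s 0 0"
| of_pair: "(d, k) \<in> r \<Longrightarrow> specializes r emb s (frag_of (a, d)) (s k a)"
| add: "specializes r emb s z a \<Longrightarrow> specializes r emb s w b \<Longrightarrow> specializes r emb s (z + w) (a + b)"
| cong: "specializes r emb s z a \<Longrightarrow> (z, w) \<in> tensor_rel s (\<lambda>k c. emb k * c) \<Longrightarrow>
    specializes r emb s w a"

locale specialization = tensor_coordinates emb scale S
  for emb :: "'k::field \<Rightarrow> 'f::field" and scale :: "'k \<Rightarrow> 'a::ab_group_add \<Rightarrow> 'a" and S +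
  fixes r :: "('f \<times> 'k) set"
  assumes partial_hom: "partial_hom r"
begin

abbreviation spec :: "('a \<times> 'f \<Rightarrow>\<^sub>0 int) \<Rightarrow> 'a \<Rightarrow> bool" where
  "spec \<equiv> specializes r emb scale"

lemma subalgebra: "subalgebra r"
  using partial_hom by (simp add: partial_hom_def)

text \<open>With respect to a basis, specialization applies the homomorphism to each coordinate. Since partial
  homomorphisms are single-valued, uniqueness of the specialization follows.\<close>

lemma specializes_coordinate:
  assumes "spec z a"
  shows "(coordinate j z, representation S a j) \<in> r"
  using assms
proof induction
  case zero
  show ?case by (simp add: coordinate_def representation_zero subalgebra_zero subalgebra)
next
  case (of_pair d k a)
  have "(emb (representation S a j) * d, representation S a j * k) \<in> r"
    by (intro subalgebra_mult subalgebra_const subalgebra of_pair)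
  then show ?case
    by (simp add: coordinate_def representation_scale independent span_eq mult.commute)
next
  case (add z a w b)
  then show ?case
    using subalgebra_add[OF subalgebra]
    by (simp add: coordinate_def frag_sum_add representation_add independent span_eq)
next
  case (cong z a w)
  then show ?case using coordinate_cong by metis
qed

lemma specializes_unique:
  assumes "spec z a" "spec z b"
  shows "a = b"
proof -
  have "representation S a j = representation S b j" for j
    using specializes_coordinate[OF assms(1)] specializes_coordinate[OF assms(2)]
    by (rule partial_hom_unique[OF partial_hom])
  then have "representation S a = representation S b" by blast
  then show ?thesis
    using sum_nonzero_representation_eq[OF independent] span_eq by (metis UNIV_I)
qed

lemma specializes_exists:
  assumes "\<And>j. coordinate j z \<in> Domain r"
  shows "\<exists>a. spec z a"
proof -
  obtain h where h: "\<And>j. (coordinate j z, h j) \<in> r"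
    using assms by (meson Domain.cases)
  obtain J where J: "finite J" "(z, \<Sum>j\<in>J. frag_of (j, coordinate j z)) \<in> tensor_eq"
    using coordinate_expansion by blast
  have "spec (\<Sum>j\<in>J. frag_of (j, coordinate j z)) (\<Sum>j\<in>J. scale (h j) j)"
    using J(1) by (induction J) (auto intro: specializes.zero specializes.add specializes.of_pair h)
  then show ?thesis using specializes.cong tensor_rel_sym[OF J(2)] by blast
qed

lemma specializes_embed: "spec (frag_of (a, 1)) a"
  using specializes.of_pair[OF subalgebra_one[OF subalgebra], of emb scale a] by simp

lemma specializes_scale:
  assumes "(d, k) \<in> r" "spec z a"
  shows "spec (pre_scale d z) (scale k a)"
  using assms(2)
proof induction
  case zero
  show ?case by (simp add: pre_scale_def specializes.zero)
next
  case (of_pair d' k' a)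
  have "(d * d', k * k') \<in> r" by (intro subalgebra_mult subalgebra assms of_pair)
  from specializes.of_pair[OF this] show ?case by (simp add: pre_scale_def)
next
  case (add z a w b)
  then show ?case
    by (simp add: pre_scale_def frag_extend_add scale_right_distrib specializes.add)
next
  case (cong z a w)
  show ?case by (rule specializes.cong[OF cong.IH pre_scale_cong[OF cong.hyps(2)]])
qed

end

lemma pre_mult_add_left: "pre_mult m (x + y) z = pre_mult m x z + pre_mult m y z"
  by (simp add: pre_mult_def frag_extend_add)

lemma pre_mult_add_right: "pre_mult m z (x + y) = pre_mult m z x + pre_mult m z y"
  using pre_mult_diff_right[of m z "x + y" y] by (simp add: algebra_simps)

locale algebra_specialization = specialization emb scale S r + nonassoc_algebra scale mul
  for emb :: "'k::field \<Rightarrow> 'f::field" and scale :: "'k \<Rightarrow> 'a::ab_group_add \<Rightarrow> 'a" and S r mul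
begin

lemma specializes_mult:
  assumes "spec z a" "spec w b"
  shows "spec (pre_mult mul z w) (mul a b)"
  using assms(1)
proof induction
  case zero
  have "mul 0 b = 0" using mult_add_left[of 0 0 b] by simp
  then show ?case by (simp add: specializes.zero)
next
  case (of_pair d k a)
  show ?case
    using assms(2)
  proof induction
    case zero
    have "mul x 0 = 0" for x using mult_add_right[of x 0 0] by simp
    then show ?case by (simp add: specializes.zero)
  next
    case (of_pair d' k' b)
    have "(d * d', k * k') \<in> r" by (intro subalgebra_mult subalgebra of_pair \<open>(d, k) \<in> r\<close>)
    from specializes.of_pair[OF this] show ?case
      by (simp add: pre_mult_def mult_scale_left mult_scale_right mult.commute[of k'])
  next
    case (add z a w b)
    then show ?case by (simp add: pre_mult_add_right mult_add_right specializes.add)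
  next
    case (cong w b w')
    show ?case by (rule specializes.cong[OF cong.IH pre_mult_cong[OF tensor_rel_refl cong.hyps(2)]])
  qed
next
  case (add z a w b)
  then show ?case by (simp add: pre_mult_add_left mult_add_left specializes.add)
next
  case (cong z a z')
  show ?case by (rule specializes.cong[OF cong.IH pre_mult_cong[OF cong.hyps(2) tensor_rel_refl]])
qed

end

section \<open>Homomorphisms between base changes\<close>

text \<open>Homomorphisms of base changes, lifted from tensors to representatives. The laws hold up to the tensor
  relations only, but no representatives have to be chosen afterwards.\<close>

definition tensor_hom ::
  "('k \<Rightarrow> 'f) \<Rightarrow> ('k \<Rightarrow> 'a \<Rightarrow> 'a) \<Rightarrow> ('a \<Rightarrow> 'a \<Rightarrow> 'a) \<Rightarrow> ('k \<Rightarrow> 'b \<Rightarrow> 'b) \<Rightarrow> ('b \<Rightarrow> 'b \<Rightarrow> 'b) \<Rightarrow>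
    (('a::ab_group_add \<times> 'f::field \<Rightarrow>\<^sub>0 int) \<Rightarrow> ('b::ab_group_add \<times> 'f \<Rightarrow>\<^sub>0 int)) \<Rightarrow> bool" where
  "tensor_hom emb s m t n \<Phi> \<longleftrightarrow>
     (\<forall>x y. (x, y) \<in> tensor_rel s (\<lambda>k c. emb k * c) \<longrightarrow> (\<Phi> x, \<Phi> y) \<in> tensor_rel t (\<lambda>k c. emb k * c)) \<and>
     (\<forall>x y. (\<Phi> (x + y), \<Phi> x + \<Phi> y) \<in> tensor_rel t (\<lambda>k c. emb k * c)) \<and>
     (\<forall>c x. (\<Phi> (pre_scale c x), pre_scale c (\<Phi> x)) \<in> tensor_rel t (\<lambda>k c. emb k * c)) \<and>
     (\<forall>x y. (\<Phi> (pre_mult m x y), pre_mult n (\<Phi> x) (\<Phi> y)) \<in> tensor_rel t (\<lambda>k c. emb k * c))"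

definition tensor_inverse ::
  "('k \<Rightarrow> 'f) \<Rightarrow> ('k \<Rightarrow> 'a \<Rightarrow> 'a) \<Rightarrow>
    (('a::ab_group_add \<times> 'f::field \<Rightarrow>\<^sub>0 int) \<Rightarrow> ('b::ab_group_add \<times> 'f \<Rightarrow>\<^sub>0 int)) \<Rightarrow>
    (('b \<times> 'f \<Rightarrow>\<^sub>0 int) \<Rightarrow> ('a \<times> 'f \<Rightarrow>\<^sub>0 int)) \<Rightarrow> bool" where
  "tensor_inverse emb s \<Phi> \<Psi> \<longleftrightarrow> (\<forall>x. (\<Psi> (\<Phi> x), x) \<in> tensor_rel s (\<lambda>k c. emb k * c))"

lemma tensor_class_eq_iff:
  "tensor_rel s t `` {x} = tensor_rel s t `` {y} \<longleftrightarrow> (x, y) \<in> tensor_rel s t"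
  using eq_equiv_class_iff[OF equiv_tensor_rel] by blast

lemma base_change_carrier:
  "alg_carrier (base_change emb s m) = range (\<lambda>x. tensor_rel s (\<lambda>k c. emb k * c) `` {x})"
  by (auto simp: base_change_def Let_def quotient_def)

lemma base_change_isomorphic_iff:
  fixes emb :: "'k::field \<Rightarrow> 'f::field"
    and s :: "'k \<Rightarrow> 'a::ab_group_add \<Rightarrow> 'a" and t :: "'k \<Rightarrow> 'b::ab_group_add \<Rightarrow> 'b"
  assumes "nonassoc_algebra s m" "nonassoc_algebra t n"
  shows "base_change emb s m \<cong>\<^sub>a base_change emb t n \<longleftrightarrow>
    (\<exists>\<Phi> \<Psi>. tensor_hom emb s m t n \<Phi> \<and> tensor_hom emb t n s m \<Psi> \<and>
      tensor_inverse emb s \<Phi> \<Psi> \<and> tensor_inverse emb t \<Psi> \<Phi>)"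
    (is "?iso \<longleftrightarrow> ?lifts")
proof -
  define cA where "cA x = tensor_rel s (\<lambda>k c. emb k * c) `` {x}" for x :: "'a \<times> 'f \<Rightarrow>\<^sub>0 int"
  define cB where "cB x = tensor_rel t (\<lambda>k c. emb k * c) `` {x}" for x :: "'b \<times> 'f \<Rightarrow>\<^sub>0 int"
  let ?A = "base_change emb s m" and ?B = "base_change emb t n"
  interpret A: nonassoc_algebra s m by fact
  interpret B: nonassoc_algebra t n by fact
  have opsA: "alg_add ?A (cA x) (cA y) = cA (x + y)" "alg_scale ?A c (cA x) = cA (pre_scale c x)"
    "alg_mult ?A (cA x) (cA y) = cA (pre_mult m x y)" for x y c
    unfolding cA_def by (rule base_change_add base_change_scale A.base_change_mult)+
  have opsB: "alg_add ?B (cB x) (cB y) = cB (x + y)" "alg_scale ?B c (cB x) = cB (pre_scale c x)"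
    "alg_mult ?B (cB x) (cB y) = cB (pre_mult n x y)" for x y c
    unfolding cB_def by (rule base_change_add base_change_scale B.base_change_mult)+
  have eqA: "(x, y) \<in> tensor_rel s (\<lambda>k c. emb k * c) \<longleftrightarrow> cA x = cA y" for x y
    by (simp add: cA_def tensor_class_eq_iff)
  have eqB: "(x, y) \<in> tensor_rel t (\<lambda>k c. emb k * c) \<longleftrightarrow> cB x = cB y" for x y
    by (simp add: cB_def tensor_class_eq_iff)
  have carA: "alg_carrier ?A = range cA" and carB: "alg_carrier ?B = range cB"
    by (simp_all add: base_change_carrier cA_def cB_def)
  have iso: "?iso \<longleftrightarrow> (\<exists>\<phi>. bij_betw \<phi> (range cA) (range cB) \<and>
      (\<forall>x y. \<phi> (cA (x + y)) = alg_add ?B (\<phi> (cA x)) (\<phi> (cA y))) \<and>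
      (\<forall>c x. \<phi> (cA (pre_scale c x)) = alg_scale ?B c (\<phi> (cA x))) \<and>
      (\<forall>x y. \<phi> (cA (pre_mult m x y)) = alg_mult ?B (\<phi> (cA x)) (\<phi> (cA y))))"
    unfolding alg_isomorphic_def carA carB by (simp add: opsA)
  show ?thesis
  proof
    assume ?iso
    then obtain \<phi> where \<phi>: "bij_betw \<phi> (range cA) (range cB)"
      "\<And>x y. \<phi> (cA (x + y)) = alg_add ?B (\<phi> (cA x)) (\<phi> (cA y))"
      "\<And>c x. \<phi> (cA (pre_scale c x)) = alg_scale ?B c (\<phi> (cA x))"
      "\<And>x y. \<phi> (cA (pre_mult m x y)) = alg_mult ?B (\<phi> (cA x)) (\<phi> (cA y))"
      unfolding iso by blast
    have img: "\<phi> ` range cA = range cB" and inj_on: "inj_on \<phi> (range cA)"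
      using \<phi>(1) by (simp_all add: bij_betw_def)
    have "\<phi> (cA x) \<in> range cB" for x unfolding img[symmetric] by (intro imageI rangeI)
    then have "\<exists>y. cB y = \<phi> (cA x)" for x by (metis rangeE)
    then obtain \<Phi> where \<Phi>: "\<And>x. cB (\<Phi> x) = \<phi> (cA x)" by metis
    have "cB y \<in> \<phi> ` range cA" for y unfolding img by (rule rangeI)
    then have "\<exists>x. \<phi> (cA x) = cB y" for y by (metis imageE rangeE)
    then obtain \<Psi> where \<Psi>: "\<And>y. \<phi> (cA (\<Psi> y)) = cB y" by metis
    have inj: "cA x = cA y" if "\<phi> (cA x) = \<phi> (cA y)" for x y
      using inj_on that by (rule inj_onD) simp_all
    have "tensor_hom emb s m t n \<Phi>"
      unfolding tensor_hom_def eqA eqB by (simp add: \<Phi> \<phi>(2-4) opsB[symmetric])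
    moreover have "tensor_hom emb t n s m \<Psi>"
      unfolding tensor_hom_def eqA eqB
      by (intro conjI allI impI; rule inj) (simp_all add: \<Psi> \<phi>(2-4) opsB)
    moreover have "tensor_inverse emb s \<Phi> \<Psi>"
      unfolding tensor_inverse_def eqA by (intro allI inj) (simp add: \<Psi> \<Phi>)
    moreover have "tensor_inverse emb t \<Psi> \<Phi>"
      unfolding tensor_inverse_def eqB by (simp add: \<Psi> \<Phi>)
    ultimately show ?lifts by blast
  next
    assume ?lifts
    then obtain \<Phi> \<Psi> where \<Phi>: "tensor_hom emb s m t n \<Phi>" and \<Psi>: "tensor_hom emb t n s m \<Psi>"
      and inv: "\<And>x. cA (\<Psi> (\<Phi> x)) = cA x" "\<And>y. cB (\<Phi> (\<Psi> y)) = cB y"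
      unfolding tensor_inverse_def eqA eqB by blast
    have \<Phi>_cong: "cB (\<Phi> x) = cB (\<Phi> y)" if "cA x = cA y" for x y
      using \<Phi>[unfolded tensor_hom_def eqA eqB, THEN conjunct1, rule_format] that .
    have \<Psi>_cong: "cA (\<Psi> x) = cA (\<Psi> y)" if "cB x = cB y" for x y
      using \<Psi>[unfolded tensor_hom_def eqA eqB, THEN conjunct1, rule_format] that .
    have \<Phi>_ops: "cB (\<Phi> (x + y)) = cB (\<Phi> x + \<Phi> y)"
      "cB (\<Phi> (pre_scale c x)) = cB (pre_scale c (\<Phi> x))"
      "cB (\<Phi> (pre_mult m x y)) = cB (pre_mult n (\<Phi> x) (\<Phi> y))" for x y c
      using \<Phi>[unfolded tensor_hom_def eqA eqB, THEN conjunct2] by simp_all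
    define \<phi> where "\<phi> X = cB (\<Phi> (SOME x. cA x = X))" for X
    have \<phi>: "\<phi> (cA x) = cB (\<Phi> x)" for x
    proof -
      have "cA (SOME y. cA y = cA x) = cA x" by (rule someI) (rule refl)
      then show ?thesis unfolding \<phi>_def by (rule \<Phi>_cong)
    qed
    have "bij_betw \<phi> (range cA) (range cB)"
    proof (rule bij_betwI')
      fix X Y assume "X \<in> range cA" "Y \<in> range cA"
      then obtain x y where xy: "X = cA x" "Y = cA y" by blast
      have "cA x = cA y" if "cB (\<Phi> x) = cB (\<Phi> y)"
        using \<Psi>_cong[OF that] inv(1) by simp
      then show "\<phi> X = \<phi> Y \<longleftrightarrow> X = Y" unfolding xy \<phi> using \<Phi>_cong by blast
    next
      fix Y assume "Y \<in> range cB"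
      then obtain y where "Y = cB y" by blast
      then have "Y = \<phi> (cA (\<Psi> y))" by (simp add: \<phi> inv)
      then show "\<exists>X\<in>range cA. Y = \<phi> X" by blast
    qed (auto simp: \<phi>)
    then show ?iso unfolding iso
      by (intro exI[of _ \<phi>]) (simp add: \<phi> opsB \<Phi>_ops)
  qed
qed

text \<open>Functoriality of the base change.\<close>

lemma tensor_hom_of_hom:
  assumes add: "\<And>x y. \<theta> (x + y) = \<theta> x + \<theta> y" and scale: "\<And>k x. \<theta> (s k x) = t k (\<theta> x)"
    and mult: "\<And>x y. \<theta> (m x y) = n (\<theta> x) (\<theta> y)"
  shows "tensor_hom emb s m t n (frag_extend (\<lambda>(a, d). frag_of (\<theta> a, d)))"
proof -
  let ?\<Theta> = "frag_extend (\<lambda>(a, d). frag_of (\<theta> a, d))"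
  have scale_eq: "?\<Theta> (pre_scale c x) = pre_scale c (?\<Theta> x)" for c x
    by (induction x rule: frag_induct) (auto simp: pre_scale_def frag_extend_diff)
  have mult_of: "?\<Theta> (pre_mult m (frag_of p) y) = pre_mult n (?\<Theta> (frag_of p)) (?\<Theta> y)" for p y
    by (induction y rule: frag_induct)
      (auto simp: pre_mult_diff_right frag_extend_diff pre_mult_def mult split: prod.split)
  have mult_eq: "?\<Theta> (pre_mult m x y) = pre_mult n (?\<Theta> x) (?\<Theta> y)" for x y
  proof (induction x rule: frag_induct)
    case 2
    show ?case by (rule mult_of)
  qed (simp_all add: pre_mult_diff_left frag_extend_diff)
  have "?\<Theta> \<rho> \<in> tensor_relators t (\<lambda>k c. emb k * c)"
    if "\<rho> \<in> tensor_relators s (\<lambda>k c. emb k * c)" for \<rho>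
    using that
    by (cases rule: tensor_relatorsE)
      (simp_all add: frag_extend_diff add scale tensor_relatorsI
        tensor_relatorsI(3)[where t = "\<lambda>k c. emb k * c"])
  then have "?\<Theta> (x - y) \<in> frag.span (tensor_relators t (\<lambda>k c. emb k * c))"
    if "x - y \<in> frag.span (tensor_relators s (\<lambda>k c. emb k * c))" for x y
    by (rule additive_span[OF frag_extend_diff frag.span_base that])
  then have "(?\<Theta> x, ?\<Theta> y) \<in> tensor_rel t (\<lambda>k c. emb k * c)"
    if "(x, y) \<in> tensor_rel s (\<lambda>k c. emb k * c)" for x y
    using that by (simp add: tensor_rel_def frag_extend_diff)
  then show ?thesis
    by (simp add: tensor_hom_def scale_eq mult_eq frag_extend_add tensor_rel_refl)
qed

lemma frag_extend_inverse:
  assumes "\<And>a. \<eta> (\<theta> a) = a"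
  shows "frag_extend (\<lambda>(b, d). frag_of (\<eta> b, d)) (frag_extend (\<lambda>(a, d). frag_of (\<theta> a, d)) x) = x"
  by (induction x rule: frag_induct) (auto simp: frag_extend_diff assms)

lemma base_change_isomorphic:
  assumes "nonassoc_algebra s m" "nonassoc_algebra t n" "alg_of s m \<cong>\<^sub>a alg_of t n"
  shows "base_change emb s m \<cong>\<^sub>a base_change emb t n"
proof -
  obtain \<theta> where \<theta>: "bij \<theta>" "\<And>x y. \<theta> (x + y) = \<theta> x + \<theta> y" "\<And>k x. \<theta> (s k x) = t k (\<theta> x)"
    "\<And>x y. \<theta> (m x y) = n (\<theta> x) (\<theta> y)"
    using assms(3) by (auto simp: alg_isomorphic_def alg_of_def)
  define \<eta> where "\<eta> = inv \<theta>"
  have inv: "\<eta> (\<theta> a) = a" "\<theta> (\<eta> b) = b" for a b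
    using \<theta>(1) by (simp_all add: \<eta>_def bij_is_inj bij_is_surj surj_f_inv_f)
  have "\<eta> (x + y) = \<eta> x + \<eta> y" "\<eta> (t k x) = s k (\<eta> x)" "\<eta> (n x y) = m (\<eta> x) (\<eta> y)" for x y k
    by (metis \<theta>(2) inv, metis \<theta>(3) inv, metis \<theta>(4) inv)
  then show ?thesis
    unfolding base_change_isomorphic_iff[OF assms(1,2)]
    using tensor_hom_of_hom[of \<theta> s t m n emb, OF \<theta>(2-4)] tensor_hom_of_hom[of \<eta> t s n m emb]
    by (intro exI conjI) (assumption | simp add: tensor_inverse_def frag_extend_inverse inv tensor_rel_refl)+
qed

section \<open>Specializing an isomorphism\<close>

text \<open>The condition \<open>defined\<close> says that the homomorphism can be applied to all entries of the matrix of \<open>\<Phi>\<close>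
  with respect to the bases \<open>S\<close> and \<open>S'\<close>.\<close>

locale specialized_hom = A: algebra_specialization emb s S r m + B: algebra_specialization emb t S' r n
  for emb :: "'k::field \<Rightarrow> 'f::field" and s :: "'k \<Rightarrow> 'a::ab_group_add \<Rightarrow> 'a" and S r m
    and t :: "'k \<Rightarrow> 'b::ab_group_add \<Rightarrow> 'b" and S' n +
  fixes \<Phi> :: "('a \<times> 'f \<Rightarrow>\<^sub>0 int) \<Rightarrow> ('b \<times> 'f \<Rightarrow>\<^sub>0 int)"
  assumes hom: "tensor_hom emb s m t n \<Phi>"
    and defined: "a \<in> S \<Longrightarrow> B.coordinate j (\<Phi> (frag_of (a, 1))) \<in> Domain r"
begin

lemma hom_cong: "(x, y) \<in> A.tensor_eq \<Longrightarrow> (\<Phi> x, \<Phi> y) \<in> B.tensor_eq"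
  and hom_add: "(\<Phi> (x + y), \<Phi> x + \<Phi> y) \<in> B.tensor_eq"
  and hom_scale: "(\<Phi> (pre_scale c x), pre_scale c (\<Phi> x)) \<in> B.tensor_eq"
  and hom_mult: "(\<Phi> (pre_mult m x y), pre_mult n (\<Phi> x) (\<Phi> y)) \<in> B.tensor_eq"
  using hom by (simp_all add: tensor_hom_def)

lemma hom_zero: "(\<Phi> 0, 0) \<in> B.tensor_eq"
  using tensor_rel_diff[OF hom_add[of 0 0] tensor_rel_refl[of "\<Phi> 0"]] by (auto intro: tensor_rel_sym)

lemma spec_hom_add:
  assumes "B.spec (\<Phi> x) b" "B.spec (\<Phi> y) b'"
  shows "B.spec (\<Phi> (x + y)) (b + b')"
  using specializes.cong[OF specializes.add[OF assms] tensor_rel_sym[OF hom_add]] .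

lemma spec_hom_scale:
  assumes "(d, k) \<in> r" "B.spec (\<Phi> x) b"
  shows "B.spec (\<Phi> (pre_scale d x)) (t k b)"
  using specializes.cong[OF B.specializes_scale[OF assms] tensor_rel_sym[OF hom_scale]] .

lemma spec_hom_mult:
  assumes "B.spec (\<Phi> x) b" "B.spec (\<Phi> y) b'"
  shows "B.spec (\<Phi> (pre_mult m x y)) (n b b')"
  using specializes.cong[OF B.specializes_mult[OF assms] tensor_rel_sym[OF hom_mult]] .

lemma spec_hom_cong:
  assumes "B.spec (\<Phi> x) b" "(x, y) \<in> A.tensor_eq"
  shows "B.spec (\<Phi> y) b"
  using specializes.cong[OF assms(1) hom_cong[OF assms(2)]] .

lemma spec_hom_embed_add:
  assumes "B.spec (\<Phi> (frag_of (a, 1))) b" "B.spec (\<Phi> (frag_of (a', 1))) b'"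
  shows "B.spec (\<Phi> (frag_of (a + a', 1))) (b + b')"
  using spec_hom_cong[OF spec_hom_add[OF assms] tensor_rel_sym[OF tensor_rel_of_add_left]] .

lemma spec_hom_embed_scale:
  assumes "B.spec (\<Phi> (frag_of (a, 1))) b"
  shows "B.spec (\<Phi> (frag_of (s k a, 1))) (t k b)"
proof -
  have "B.spec (\<Phi> (pre_scale (emb k) (frag_of (a, 1)))) (t k b)"
    by (intro spec_hom_scale assms A.subalgebra_const A.subalgebra)
  moreover have "(pre_scale (emb k) (frag_of (a, 1)), frag_of (s k a, 1)) \<in> A.tensor_eq"
    using tensor_rel_sym[OF tensor_rel_of_scale[of s k a 1 "\<lambda>k c. emb k * c"]]
    by (simp add: pre_scale_def)
  ultimately show ?thesis by (rule spec_hom_cong)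
qed

lemma spec_hom_embed_exists: "\<exists>b. B.spec (\<Phi> (frag_of (a, 1))) b"
proof -
  have "a \<in> A.span S" by (simp add: A.span_eq)
  then show ?thesis
  proof (induction rule: A.span_induct_alt)
    case base
    have "(\<Phi> 0, \<Phi> (frag_of (0, 1))) \<in> B.tensor_eq"
      by (rule hom_cong[OF tensor_rel_sym[OF tensor_rel_of_zero_left]])
    then show ?case
      using specializes.cong[OF specializes.cong[OF specializes.zero tensor_rel_sym[OF hom_zero]]] by blast
  next
    case (step k a a')
    obtain b where "B.spec (\<Phi> (frag_of (a, 1))) b"
      using B.specializes_exists[OF defined[OF step.hyps]] by blast
    moreover obtain b' where "B.spec (\<Phi> (frag_of (a', 1))) b'" using step.IH by blast
    ultimately show ?case using spec_hom_embed_add spec_hom_embed_scale by blast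
  qed
qed

text \<open>The linear map whose matrix is the image of the matrix of \<open>\<Phi>\<close> under the homomorphism: \<open>a\<close> goes to
  the specialization of \<open>\<Phi> (a \<otimes> 1)\<close>. Its algebraic properties follow from those of \<open>\<Phi>\<close> because
  specializations are unique.\<close>

definition induced :: "'a \<Rightarrow> 'b" where
  "induced a = (THE b. B.spec (\<Phi> (frag_of (a, 1))) b)"

lemma spec_induced: "B.spec (\<Phi> (frag_of (a, 1))) (induced a)"
proof -
  have "\<exists>!b. B.spec (\<Phi> (frag_of (a, 1))) b"
    using spec_hom_embed_exists B.specializes_unique by blast
  then show ?thesis unfolding induced_def by (rule theI')
qed

lemma induced_add: "induced (a + a') = induced a + induced a'"
  by (rule B.specializes_unique[OF spec_induced spec_hom_embed_add[OF spec_induced spec_induced]])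

lemma induced_scale: "induced (s k a) = t k (induced a)"
  by (rule B.specializes_unique[OF spec_induced spec_hom_embed_scale[OF spec_induced]])

lemma induced_mult: "induced (m a a') = n (induced a) (induced a')"
proof -
  have "B.spec (\<Phi> (frag_of (m a a', 1))) (n (induced a) (induced a'))"
    using spec_hom_mult[OF spec_induced spec_induced, of a a'] by (simp add: pre_mult_def)
  then show ?thesis by (rule B.specializes_unique[OF spec_induced])
qed

text \<open>Specialization intertwines \<open>\<Phi>\<close> with the induced map. This makes \<open>induced\<close> compatible with composition,
  so mutually inverse maps induce mutually inverse maps.\<close>

lemma spec_hom_induced:
  assumes "A.spec z a"
  shows "B.spec (\<Phi> z) (induced a)"
  using assms
proof induction
  case zero
  have "induced 0 = 0" using induced_add[of 0 0] by simp
  then show ?case using specializes.cong[OF specializes.zero tensor_rel_sym[OF hom_zero]] by simp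
next
  case (of_pair d k a)
  then show ?case
    using spec_hom_scale[OF of_pair spec_induced[of a]] by (simp add: pre_scale_def induced_scale)
next
  case (add z a w b)
  then show ?case by (simp add: induced_add spec_hom_add)
next
  case (cong z a w)
  show ?case by (rule spec_hom_cong[OF cong.IH cong.hyps(2)])
qed

end

text \<open>The matrices of an isomorphism and of its inverse have finitely many nonzero entries in each row,
  and hence fewer than \<open>|K|\<close> different entries. By lemma \<open>partial_hom_on_small_set\<close>, one homomorphism
  to \<open>K\<close> applies to all of them, and the induced maps are inverse to each other.\<close>

lemma (in alg_closed_extension) isomorphic_of_base_change_isomorphic:
  assumes A: "nonassoc_algebra s m" and B: "nonassoc_algebra t n"
    and S: "module.independent s S" "module.span s S = UNIV" "|S| <o |UNIV :: 'k set|"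
    and S': "module.independent t S'" "module.span t S' = UNIV" "|S'| <o |UNIV :: 'k set|"
    and iso: "base_change emb s m \<cong>\<^sub>a base_change emb t n"
  shows "alg_of s m \<cong>\<^sub>a alg_of t n"
proof -
  interpret A0: nonassoc_algebra s m by fact
  interpret B0: nonassoc_algebra t n by fact
  interpret A1: tensor_coordinates emb s S by unfold_locales (use S in simp_all)
  interpret B1: tensor_coordinates emb t S' by unfold_locales (use S' in simp_all)
  obtain \<Phi> \<Psi> where hom: "tensor_hom emb s m t n \<Phi>" "tensor_hom emb t n s m \<Psi>"
    and inv: "tensor_inverse emb s \<Phi> \<Psi>" "tensor_inverse emb t \<Psi> \<Phi>"
    using iso unfolding base_change_isomorphic_iff[OF A B] by blast
  define G1 where "G1 = (\<Union>a\<in>S. range (\<lambda>j. B1.coordinate j (\<Phi> (frag_of (a, 1)))))"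
  define G2 where "G2 = (\<Union>b\<in>S'. range (\<lambda>j. A1.coordinate j (\<Psi> (frag_of (b, 1)))))"
  have "|G1| <o |UNIV :: 'k set|" "|G2| <o |UNIV :: 'k set|"
    unfolding G1_def G2_def
    by (intro card_UNION_finite_less infinite_alg_closed_field S S'
      A1.finite_coordinates B1.finite_coordinates)+
  then have "|G1 \<union> G2| <o |UNIV :: 'k set|"
    by (rule card_of_Un_ordLess_infinite[OF infinite_alg_closed_field])
  then obtain r where r: "partial_hom r" "G1 \<union> G2 \<subseteq> Domain r"
    using partial_hom_on_small_set by blast
  have def1: "B1.coordinate j (\<Phi> (frag_of (a, 1))) \<in> Domain r" if "a \<in> S" for a j
  proof -
    have "B1.coordinate j (\<Phi> (frag_of (a, 1))) \<in> G1" unfolding G1_def using that by blast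
    then show ?thesis using r(2) by blast
  qed
  have def2: "A1.coordinate j (\<Psi> (frag_of (b, 1))) \<in> Domain r" if "b \<in> S'" for b j
  proof -
    have "A1.coordinate j (\<Psi> (frag_of (b, 1))) \<in> G2" unfolding G2_def using that by blast
    then show ?thesis using r(2) by blast
  qed
  interpret A: algebra_specialization emb s S r m by unfold_locales (fact r(1))
  interpret B: algebra_specialization emb t S' r n by unfold_locales (fact r(1))
  interpret AB: specialized_hom emb s S r m t S' n \<Phi>
    by unfold_locales (fact hom(1), fact def1)
  interpret BA: specialized_hom emb t S' r n s S m \<Psi>
    by unfold_locales (fact hom(2), fact def2)
  have AB: "BA.induced (AB.induced a) = a" for a
  proof -
    have "A.spec (\<Psi> (\<Phi> (frag_of (a, 1)))) (BA.induced (AB.induced a))"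
      by (rule BA.spec_hom_induced[OF AB.spec_induced])
    then have "A.spec (frag_of (a, 1)) (BA.induced (AB.induced a))"
      by (rule specializes.cong) (use inv(1) in \<open>simp add: tensor_inverse_def\<close>)
    then show ?thesis using A.specializes_embed by (rule A.specializes_unique)
  qed
  have BA: "AB.induced (BA.induced b) = b" for b
  proof -
    have "B.spec (\<Phi> (\<Psi> (frag_of (b, 1)))) (AB.induced (BA.induced b))"
      by (rule AB.spec_hom_induced[OF BA.spec_induced])
    then have "B.spec (frag_of (b, 1)) (AB.induced (BA.induced b))"
      by (rule specializes.cong) (use inv(2) in \<open>simp add: tensor_inverse_def\<close>)
    then show ?thesis using B.specializes_embed by (rule B.specializes_unique)
  qed
  have "bij AB.induced" by (rule o_bij[of BA.induced]) (auto simp: AB BA)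
  then show ?thesis
    unfolding alg_isomorphic_def alg_of_def
    by (intro exI[of _ AB.induced]) (simp add: AB.induced_add AB.induced_scale AB.induced_mult)
qed

theorem theorem5p2:
  fixes emb :: "'k::alg_closed_field \<Rightarrow> 'f::field"
    and scaleA :: "'k \<Rightarrow> 'a::ab_group_add \<Rightarrow> 'a" and multA :: "'a \<Rightarrow> 'a \<Rightarrow> 'a"
    and scaleB :: "'k \<Rightarrow> 'b::ab_group_add \<Rightarrow> 'b" and multB :: "'b \<Rightarrow> 'b \<Rightarrow> 'b"
    and \<omega> :: "'w rel"
  assumes "field_extension emb"
    and "nonassoc_algebra scaleA multA"
    and "nonassoc_algebra scaleB multB"
    and "vector_space.has_dimension scaleA \<omega>"
    and "vector_space.has_dimension scaleB \<omega>"
    and "\<omega> <o |UNIV :: 'k set|"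
  shows "base_change emb scaleA multA \<cong>\<^sub>a base_change emb scaleB multB \<longleftrightarrow>
         alg_of scaleA multA \<cong>\<^sub>a alg_of scaleB multB"
proof
  interpret alg_closed_extension emb
    using assms(1) by (simp add: alg_closed_extension_def)
  interpret A: nonassoc_algebra scaleA multA by fact
  interpret B: nonassoc_algebra scaleB multB by fact
  obtain S where S: "A.independent S" "A.span S = UNIV" "|S| =o \<omega>"
    using assms(4) by (auto simp: A.has_dimension_def)
  obtain S' where S': "B.independent S'" "B.span S' = UNIV" "|S'| =o \<omega>"
    using assms(5) by (auto simp: B.has_dimension_def)
  assume "base_change emb scaleA multA \<cong>\<^sub>a base_change emb scaleB multB"
  then show "alg_of scaleA multA \<cong>\<^sub>a alg_of scaleB multB"
    using ordIso_ordLess_trans[OF S(3) assms(6)] ordIso_ordLess_trans[OF S'(3) assms(6)]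
    by (intro isomorphic_of_base_change_isomorphic[OF assms(2,3) S(1,2) _ S'(1,2)])
qed (rule base_change_isomorphic[OF assms(2,3)])

end
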